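(* Let $f\colon M^2\to(\mathbf{R}^3,g_0)$ be a front into Euclidean $3$-space, $p\in M^2$ a cuspidal edge, and $\gamma$ the singular curve with $\gamma(0)=p$; put $\hat\gamma=f\circ\gamma$. Let $T$ be the rectifying plane of $\hat\gamma$ at $p$, i.e. the plane through $f(p)$ perpendicular to the principal normal vector of $\hat\gamma$ at $p$. Let $D_+$ be the closed half-space bounded by $T$ into which the principal normal vector of $\hat\gamma$ at $p$ points, and $D_-$ the opposite closed half-space. If the singular curvature at $p$ is positive (resp. negative), then for every null curve $\sigma(s)$ with $\sigma(0)=p$, the point $f(\sigma(s))$ lies in $D_+$ (resp. $D_-$) for all sufficiently small $s$. Moreover, if the singular curvature at $p$ is positive, then the image under $f$ of a neighborhood of $p$ lies in $D_+$.
   Context: All objects are $C^\infty$; $M^2$ is an oriented $2$-manifold. A smooth map $f\colon M^2\to\mathbf{R}^3$ is a front if there is a unit vector field $\nu$ along $f$ with $g_0(f_*X,\nu)=0$ for all $X\in TM^2$ and such that $(f,\nu)\colon M^2\to\mathbf{R}^3\times S^2$ is an immersion. In local coordinates $(u,v)$ compatible with the orientation of $M^2$, $\lambda=\det(f_u,f_v,\nu)$. Singular points are the points where $f$ is not an immersion ($\lambda=0$). A cuspidal edge is a singular point at which $f$ is locally diffeomorphic (by diffeomorphism germs of source and target) to $(u,v)\mapsto(u^2,u^3,v)$ at $(0,0)$; near it the singular set is a regular curve $\gamma(t)$ (singular curve), and the kernel of $f_*$ is a line (null direction, spanned by null vectors) transversal to $\gamma'$. The singular curvature is $$\kappa_s=\mathrm{sgn}(d\lambda(\eta))\,\det(\hat\gamma',\hat\gamma'',\nu)/|\hat\gamma'|^3,$$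 with $\eta$ a null vector field along $\gamma$ such that $(\gamma',\eta)$ is positively oriented. (If $\kappa_s\neq0$ at $p$, the space curve $\hat\gamma$ has nonzero curvature at $p$, so its principal normal is defined.) A null curve is a regular curve $\sigma(s)$ in $M^2$ such that $\sigma'(s)$ is a null vector whenever $\sigma(s)$ is a singular point. *)

theory Defs
  imports "HOL-Analysis.Analysis"
begin

section \<open>Smooth maps between Euclidean spaces\<close>

text \<open>Only meant for open \<open>S\<close>: the derivatives are taken with respect to the full space.\<close>

primrec times_differentiable_on ::
    "nat \<Rightarrow> 'a::real_normed_vector set \<Rightarrow> ('a \<Rightarrow> 'b::real_normed_vector) \<Rightarrow> bool" where
  "times_differentiable_on 0 S f \<longleftrightarrow> continuous_on S f"
| "times_differentiable_on (Suc n) S f \<longleftrightarrow>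
     (\<forall>x\<in>S. f differentiable (at x)) \<and>
     (\<forall>v. times_differentiable_on n S (\<lambda>x. frechet_derivative f (at x) v))"

definition smooth_on :: "'a::real_normed_vector set \<Rightarrow> ('a \<Rightarrow> 'b::real_normed_vector) \<Rightarrow> bool" where
  "smooth_on S f \<longleftrightarrow> (\<forall>n. times_differentiable_on n S f)"

definition diffeomorphism_on ::
    "'a::real_normed_vector set \<Rightarrow> ('a \<Rightarrow> 'b::real_normed_vector) \<Rightarrow> bool" where
  "diffeomorphism_on S h \<longleftrightarrow>
     open S \<and> open (h ` S) \<and> inj_on h S \<and> smooth_on S h \<and> smooth_on (h ` S) (inv_into S h)"

section \<open>Oriented surfaces\<close>

text \<open>A chart is a pair of its domain and its coordinate map; the values of the coordinate map
  outside the domain are irrelevant. Tangent vectors at a point are represented by their coordinates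
  in a given chart.\<close>

type_synonym 'a chart = "'a set \<times> ('a \<Rightarrow> real^2)"

definition in_coords :: "'a chart \<Rightarrow> ('a \<Rightarrow> 'b) \<Rightarrow> real^2 \<Rightarrow> 'b" where
  "in_coords c f = (\<lambda>x. f (inv_into (fst c) (snd c) x))"

definition chart_on :: "'a topology \<Rightarrow> 'a chart \<Rightarrow> bool" where
  "chart_on X c \<longleftrightarrow> openin X (fst c) \<and> open (snd c ` fst c) \<and>
     homeomorphic_map (subtopology X (fst c)) (top_of_set (snd c ` fst c)) (snd c)"

text \<open>\<open>A\<close> is an atlas of charts compatible with the orientation. It need not be maximal.\<close>

definition oriented_surface :: "'a topology \<Rightarrow> 'a chart set \<Rightarrow> bool" where
  "oriented_surface X A \<longleftrightarrow>
     Hausdorff_space X \<and> second_countable X \<and>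
     (\<forall>c\<in>A. chart_on X c) \<and> (\<Union>c\<in>A. fst c) = topspace X \<and>
     (\<forall>c\<in>A. \<forall>d\<in>A.
        smooth_on (snd c ` (fst c \<inter> fst d)) (in_coords c (snd d)) \<and>
        (\<forall>x \<in> snd c ` (fst c \<inter> fst d).
           det (matrix (frechet_derivative (in_coords c (snd d)) (at x))) > 0))"

definition smooth_map :: "'a chart set \<Rightarrow> ('a \<Rightarrow> 'b::real_normed_vector) \<Rightarrow> bool" where
  "smooth_map A f \<longleftrightarrow> (\<forall>c\<in>A. smooth_on (snd c ` fst c) (in_coords c f))"

definition diff_at :: "'a chart \<Rightarrow> ('a \<Rightarrow> 'b::real_normed_vector) \<Rightarrow> 'a \<Rightarrow> real^2 \<Rightarrow> 'b" where
  "diff_at c f p = frechet_derivative (in_coords c f) (at (snd c p))"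

definition immersion_at :: "'a chart set \<Rightarrow> ('a \<Rightarrow> 'b::real_normed_vector) \<Rightarrow> 'a \<Rightarrow> bool" where
  "immersion_at A f p \<longleftrightarrow> (\<forall>c\<in>A. p \<in> fst c \<longrightarrow> inj (diff_at c f p))"

section \<open>Fronts and cuspidal edges\<close>

text \<open>Since \<open>\<nu>\<close> takes values in the unit sphere, \<open>(f, \<nu>)\<close> is an immersion into the product of space
  and the sphere iff it is an immersion into the product of two copies of space.\<close>

definition front :: "'a topology \<Rightarrow> 'a chart set \<Rightarrow> ('a \<Rightarrow> real^3) \<Rightarrow> ('a \<Rightarrow> real^3) \<Rightarrow> bool" where
  "front X A f \<nu> \<longleftrightarrow>
     smooth_map A f \<and> smooth_map A \<nu> \<and>
     (\<forall>p \<in> topspace X. norm (\<nu> p) = 1) \<and>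
     (\<forall>c\<in>A. \<forall>p \<in> fst c. \<forall>v. diff_at c f p v \<bullet> \<nu> p = 0) \<and>
     (\<forall>p \<in> topspace X. immersion_at A (\<lambda>q. (f q, \<nu> q)) p)"

definition singular_points :: "'a topology \<Rightarrow> 'a chart set \<Rightarrow> ('a \<Rightarrow> real^3) \<Rightarrow> 'a set" where
  "singular_points X A f = {p \<in> topspace X. \<not> immersion_at A f p}"

definition cuspidal_edge :: "'a topology \<Rightarrow> 'a chart set \<Rightarrow> ('a \<Rightarrow> real^3) \<Rightarrow> 'a \<Rightarrow> bool" where
  "cuspidal_edge X A f p \<longleftrightarrow>
     p \<in> singular_points X A f \<and>
     (\<exists>c\<in>A. p \<in> fst c \<and>
        (\<exists>W (\<phi> :: real^2 \<Rightarrow> real^2) V (\<Phi> :: real^3 \<Rightarrow> real^3).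
           diffeomorphism_on W \<phi> \<and> 0 \<in> W \<and> \<phi> 0 = snd c p \<and> \<phi> ` W \<subseteq> snd c ` fst c \<and>
           diffeomorphism_on V \<Phi> \<and> f p \<in> V \<and> in_coords c f ` \<phi> ` W \<subseteq> V \<and>
           (\<forall>w\<in>W. \<Phi> (in_coords c f (\<phi> w)) = vector [(w $ 1)^2, (w $ 1)^3, w $ 2])))"

definition null_vector :: "'a chart \<Rightarrow> ('a \<Rightarrow> real^3) \<Rightarrow> 'a \<Rightarrow> real^2 \<Rightarrow> bool" where
  "null_vector c f p v \<longleftrightarrow> v \<noteq> 0 \<and> diff_at c f p v = 0"

section \<open>Curves on the surface\<close>

definition velocity :: "'a chart \<Rightarrow> (real \<Rightarrow> 'a) \<Rightarrow> real \<Rightarrow> real^2" where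
  "velocity c \<gamma> t = vector_derivative (\<lambda>s. snd c (\<gamma> s)) (at t)"

definition regular_curve :: "'a topology \<Rightarrow> 'a chart set \<Rightarrow> real set \<Rightarrow> (real \<Rightarrow> 'a) \<Rightarrow> bool" where
  "regular_curve X A I \<gamma> \<longleftrightarrow>
     open I \<and> is_interval I \<and> continuous_map (top_of_set I) X \<gamma> \<and>
     (\<forall>c\<in>A. smooth_on {t \<in> I. \<gamma> t \<in> fst c} (\<lambda>t. snd c (\<gamma> t)) \<and>
            (\<forall>t\<in>I. \<gamma> t \<in> fst c \<longrightarrow> velocity c \<gamma> t \<noteq> 0))"

text \<open>\<open>\<gamma>\<close> is a regular parametrization of the singular set near \<open>p\<close>, with \<open>\<gamma> 0 = p\<close>.\<close>

definition singular_curve ::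
    "'a topology \<Rightarrow> 'a chart set \<Rightarrow> ('a \<Rightarrow> real^3) \<Rightarrow> 'a \<Rightarrow> real set \<Rightarrow> (real \<Rightarrow> 'a) \<Rightarrow> bool" where
  "singular_curve X A f p I \<gamma> \<longleftrightarrow>
     regular_curve X A I \<gamma> \<and> 0 \<in> I \<and> \<gamma> 0 = p \<and> \<gamma> ` I \<subseteq> singular_points X A f \<and>
     (\<exists>U. openin X U \<and> p \<in> U \<and> singular_points X A f \<inter> U \<subseteq> \<gamma> ` I)"

definition null_curve ::
    "'a topology \<Rightarrow> 'a chart set \<Rightarrow> ('a \<Rightarrow> real^3) \<Rightarrow> real set \<Rightarrow> (real \<Rightarrow> 'a) \<Rightarrow> bool" where
  "null_curve X A f J \<sigma> \<longleftrightarrow>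
     regular_curve X A J \<sigma> \<and>
     (\<forall>s\<in>J. \<sigma> s \<in> singular_points X A f \<longrightarrow>
        (\<forall>c\<in>A. \<sigma> s \<in> fst c \<longrightarrow> null_vector c f (\<sigma> s) (velocity c \<sigma> s)))"

section \<open>Singular curvature\<close>

definition det2 :: "real^2 \<Rightarrow> real^2 \<Rightarrow> real" where
  "det2 a b = det (vector [a, b] :: real^2^2)"

definition det3 :: "real^3 \<Rightarrow> real^3 \<Rightarrow> real^3 \<Rightarrow> real" where
  "det3 a b c = det (vector [a, b, c] :: real^3^3)"

text \<open>The function \<open>\<lambda> = det (f\<^sub>u, f\<^sub>v, \<nu>)\<close>, as a function of the coordinates \<open>x = (u, v)\<close> of the
  chart \<open>c\<close>.\<close>

definition signed_area_density ::
    "'a chart \<Rightarrow> ('a \<Rightarrow> real^3) \<Rightarrow> ('a \<Rightarrow> real^3) \<Rightarrow> real^2 \<Rightarrow> real" where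
  "signed_area_density c f \<nu> x =
     det3 (frechet_derivative (in_coords c f) (at x) (axis 1 1))
          (frechet_derivative (in_coords c f) (at x) (axis 2 1))
          (in_coords c \<nu> x)"

text \<open>The singular curvature computed in the chart \<open>c\<close> with the null vector \<open>\<eta>\<close> at \<open>\<gamma> t\<close>.\<close>

definition singular_curvature_via ::
    "'a chart \<Rightarrow> real^2 \<Rightarrow> ('a \<Rightarrow> real^3) \<Rightarrow> ('a \<Rightarrow> real^3) \<Rightarrow> (real \<Rightarrow> 'a) \<Rightarrow> real \<Rightarrow> real" where
  "singular_curvature_via c \<eta> f \<nu> \<gamma> t =
     (let c1 = (\<lambda>s. vector_derivative (f \<circ> \<gamma>) (at s));
          c2 = (\<lambda>s. vector_derivative c1 (at s))
      in sgn (frechet_derivative (signed_area_density c f \<nu>) (at (snd c (\<gamma> t))) \<eta>) *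
         det3 (c1 t) (c2 t) (\<nu> (\<gamma> t)) / norm (c1 t) ^ 3)"

text \<open>Along a curve of cuspidal edges, the value depends neither on the choice of the chart
  of the oriented atlas nor on that of the null vector \<open>\<eta>\<close> for which \<open>(\<gamma>', \<eta>)\<close> is positively
  oriented.\<close>

definition singular_curvature ::
    "'a chart set \<Rightarrow> ('a \<Rightarrow> real^3) \<Rightarrow> ('a \<Rightarrow> real^3) \<Rightarrow> (real \<Rightarrow> 'a) \<Rightarrow> real \<Rightarrow> real" where
  "singular_curvature A f \<nu> \<gamma> t =
     (SOME k. \<exists>c\<in>A. \<exists>\<eta>. \<gamma> t \<in> fst c \<and> null_vector c f (\<gamma> t) \<eta> \<and> det2 (velocity c \<gamma> t) \<eta> > 0 \<and>
        k = singular_curvature_via c \<eta> f \<nu> \<gamma> t)"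

section \<open>The rectifying plane of a space curve\<close>

definition unit_tangent :: "(real \<Rightarrow> real^3) \<Rightarrow> real \<Rightarrow> real^3" where
  "unit_tangent \<alpha> t = sgn (vector_derivative \<alpha> (at t))"

definition principal_normal :: "(real \<Rightarrow> real^3) \<Rightarrow> real \<Rightarrow> real^3" where
  "principal_normal \<alpha> t = sgn (vector_derivative (unit_tangent \<alpha>) (at t))"

definition rectifying_plane :: "(real \<Rightarrow> real^3) \<Rightarrow> real \<Rightarrow> (real^3) set" where
  "rectifying_plane \<alpha> t = {x. principal_normal \<alpha> t \<bullet> (x - \<alpha> t) = 0}"

definition D_plus :: "(real \<Rightarrow> real^3) \<Rightarrow> real \<Rightarrow> (real^3) set" where
  "D_plus \<alpha> t = {x. principal_normal \<alpha> t \<bullet> (x - \<alpha> t) \<ge> 0}"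

definition D_minus :: "(real \<Rightarrow> real^3) \<Rightarrow> real \<Rightarrow> (real^3) set" where
  "D_minus \<alpha> t = {x. principal_normal \<alpha> t \<bullet> (x - \<alpha> t) \<le> 0}"

lemma frontier_D_plus:
  "principal_normal \<alpha> t \<noteq> 0 \<Longrightarrow> frontier (D_plus \<alpha> t) = rectifying_plane \<alpha> t"
  using frontier_halfspace_ge[of "principal_normal \<alpha> t" "principal_normal \<alpha> t \<bullet> \<alpha> t"]
  by (simp add: D_plus_def rectifying_plane_def inner_diff_right)

lemma frontier_D_minus:
  "principal_normal \<alpha> t \<noteq> 0 \<Longrightarrow> frontier (D_minus \<alpha> t) = rectifying_plane \<alpha> t"
  using frontier_halfspace_le[of "principal_normal \<alpha> t" "principal_normal \<alpha> t \<bullet> \<alpha> t"]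
  by (simp add: D_minus_def rectifying_plane_def inner_diff_right)

end

theory Submission
  imports Defs
begin

text \<open>
  Near the cuspidal edge, \<open>f = \<Psi> (u\<^sup>2, u\<^sup>3, v)\<close> in suitable coordinates \<open>(u, v)\<close>, with \<open>\<Psi>\<close> a local
  diffeomorphism of space. Let \<open>n\<close> be the principal normal of the singular image
  \<open>\<psi> z = \<Psi> (0, 0, z)\<close> at the origin and put \<open>a = \<Psi>\<^sub>x\<close>, \<open>b = \<Psi>\<^sub>z\<close>, \<open>q = \<Psi>\<^sub>z\<^sub>z\<close> there. Both \<open>a\<close> and
  \<open>b\<close> are orthogonal to the unit normal \<open>\<nu>\<close>, so a Gram determinant identity shows that the
  singular curvature has the sign of \<open>n \<bullet> a\<close>; moreover \<open>n \<bullet> b = 0 < n \<bullet> q\<close>. The height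
  of \<open>f\<close> over the rectifying plane is the sum of \<open>n \<bullet> (\<Psi> (u\<^sup>2, u\<^sup>3, v) - \<psi> v)\<close>, which by the mean
  value theorem is \<open>u\<^sup>2\<close> times a quantity close to \<open>n \<bullet> a\<close>, and of
  \<open>n \<bullet> (\<psi> v - \<psi> 0)\<close>, which is nonnegative and \<open>O(v\<^sup>2)\<close>. If \<open>n \<bullet> a > 0\<close> both are nonnegative.
  If \<open>n \<bullet> a < 0\<close> the first one dominates along a null curve, where \<open>v = o(u)\<close>.
\<close>

section \<open>Calculus of smooth maps\<close>

lemma times_differentiable_on_Suc_imp:
  "times_differentiable_on (Suc n) S f \<Longrightarrow> times_differentiable_on n S f"
proof (induction n arbitrary: f)
  case 0
  then show ?case
    by (simp add: continuous_at_imp_continuous_on differentiable_imp_continuous_within)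
next
  case (Suc n)
  then show ?case by (metis times_differentiable_on.simps(2))
qed

lemma times_differentiable_on_subset:
  "times_differentiable_on n S f \<Longrightarrow> T \<subseteq> S \<Longrightarrow> times_differentiable_on n T f"
  by (induction n arbitrary: f) (auto intro: continuous_on_subset)

text \<open>On an open set the equality holds near each point and so passes to the derivatives. In
  the inductions below this lets an explicit formula stand in for
  \<open>frechet_derivative\<close>.\<close>

lemma times_differentiable_on_cong:
  assumes "open S" "\<And>x. x \<in> S \<Longrightarrow> f x = g x" "times_differentiable_on n S f"
  shows "times_differentiable_on n S g"
  using assms(2,3)
proof (induction n arbitrary: f g)
  case 0
  then show ?case by (simp add: continuous_on_eq)
next
  case (Suc n)
  have D: "(g has_derivative frechet_derivative f (at x)) (at x)" if "x \<in> S" for x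
    using that Suc.prems \<open>open S\<close>
    by (auto simp: frechet_derivative_works intro: has_derivative_transform_within_open)
  then have eq: "frechet_derivative f (at x) = frechet_derivative g (at x)" if "x \<in> S" for x
    using that frechet_derivative_at by blast
  have "times_differentiable_on n S (\<lambda>x. frechet_derivative g (at x) v)" for v
    by (rule Suc.IH[of "\<lambda>x. frechet_derivative f (at x) v"]) (use Suc.prems eq in auto)
  then show ?case
    using D by (auto simp: differentiable_def)
qed

lemma times_differentiable_on_const: "times_differentiable_on n S (\<lambda>x. c)"
proof (induction n arbitrary: c)
  case (Suc n)
  have "frechet_derivative (\<lambda>x::'a. c) (at x) = (\<lambda>v. 0)" for x
    by (rule frechet_derivative_at[symmetric]) (rule has_derivative_const)
  with Suc show ?case by simp
qed simp

lemma times_differentiable_on_bounded_linear: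
  assumes "bounded_linear L"
  shows "times_differentiable_on n S f \<Longrightarrow> open S \<Longrightarrow> times_differentiable_on n S (\<lambda>x. L (f x))"
proof (induction n arbitrary: f)
  case 0
  then show ?case by (simp add: bounded_linear.continuous_on[OF assms])
next
  case (Suc n)
  have D: "((\<lambda>x. L (f x)) has_derivative (\<lambda>v. L (frechet_derivative f (at x) v))) (at x)"
    if "x \<in> S" for x
    by (rule bounded_linear.has_derivative[OF assms frechet_derivative_works[THEN iffD1]])
       (use that Suc.prems in simp)
  have "times_differentiable_on n S (\<lambda>x. frechet_derivative (\<lambda>x. L (f x)) (at x) v)" for v
  proof (rule times_differentiable_on_cong[OF \<open>open S\<close>])
    show "times_differentiable_on n S (\<lambda>x. L (frechet_derivative f (at x) v))"
      by (intro Suc.IH \<open>open S\<close>) (use Suc.prems in simp)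
  qed (simp add: frechet_derivative_at[OF D, symmetric])
  then show ?case
    using D by (auto simp: differentiable_def)
qed

lemma times_differentiable_on_add:
  "times_differentiable_on n S f \<Longrightarrow> times_differentiable_on n S g \<Longrightarrow> open S
    \<Longrightarrow> times_differentiable_on n S (\<lambda>x. f x + g x)"
proof (induction n arbitrary: f g)
  case 0
  then show ?case by (simp add: continuous_on_add)
next
  case (Suc n)
  have D: "((\<lambda>x. f x + g x) has_derivative
      (\<lambda>v. frechet_derivative f (at x) v + frechet_derivative g (at x) v)) (at x)"
    if "x \<in> S" for x
    by (intro has_derivative_add frechet_derivative_works[THEN iffD1]) (use that Suc.prems in simp_all)
  have "times_differentiable_on n S (\<lambda>x. frechet_derivative (\<lambda>x. f x + g x) (at x) v)" for v
  proof (rule times_differentiable_on_cong[OF \<open>open S\<close>])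
    show "times_differentiable_on n S
        (\<lambda>x. frechet_derivative f (at x) v + frechet_derivative g (at x) v)"
      by (intro Suc.IH \<open>open S\<close>) (use Suc.prems in simp_all)
  qed (simp add: frechet_derivative_at[OF D, symmetric])
  then show ?case
    using D by (auto simp: differentiable_def)
qed

lemma times_differentiable_on_bilinear:
  assumes "bounded_bilinear B"
  shows "times_differentiable_on n S f \<Longrightarrow> times_differentiable_on n S g \<Longrightarrow> open S
    \<Longrightarrow> times_differentiable_on n S (\<lambda>x. B (f x) (g x))"
proof (induction n arbitrary: f g)
  case 0
  then show ?case by (simp add: bounded_bilinear.continuous_on[OF assms])
next
  case (Suc n)
  have D: "((\<lambda>x. B (f x) (g x)) has_derivative
      (\<lambda>v. B (f x) (frechet_derivative g (at x) v) + B (frechet_derivative f (at x) v) (g x))) (at x)"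
    if "x \<in> S" for x
    by (intro bounded_bilinear.FDERIV[OF assms] frechet_derivative_works[THEN iffD1])
       (use that Suc.prems in simp_all)
  have "times_differentiable_on n S (\<lambda>x. frechet_derivative (\<lambda>x. B (f x) (g x)) (at x) v)" for v
  proof (rule times_differentiable_on_cong[OF \<open>open S\<close>])
    show "times_differentiable_on n S
      (\<lambda>x. B (f x) (frechet_derivative g (at x) v) + B (frechet_derivative f (at x) v) (g x))"
      by (intro times_differentiable_on_add Suc.IH \<open>open S\<close>)
         (use Suc.prems times_differentiable_on_Suc_imp in auto)
  qed (simp add: frechet_derivative_at[OF D, symmetric])
  then show ?case
    using D by (auto simp: differentiable_def)
qed

lemma times_differentiable_on_sum:
  assumes "finite I" "\<And>i. i \<in> I \<Longrightarrow> times_differentiable_on n S (f i)" "open S"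
  shows "times_differentiable_on n S (\<lambda>x. \<Sum>i\<in>I. f i x)"
  using assms
  by (induction I rule: finite_induct) (auto simp: times_differentiable_on_const times_differentiable_on_add)

text \<open>The chain rule evaluates the derivative of \<open>g\<close> in a direction that moves
  with \<open>x\<close>, whereas the inductive definition only allows fixed directions. Expanding
  the direction in \<open>Basis\<close> leaves a finite sum of scalar functions times derivatives of
  \<open>g\<close> in fixed directions, to which the induction hypothesis applies.\<close>

lemma times_differentiable_on_compose:
  fixes f :: "'a::real_normed_vector \<Rightarrow> 'b::euclidean_space"
    and g :: "'b \<Rightarrow> 'c::real_normed_vector"
  assumes "open S" "open T" "f ` S \<subseteq> T"
  shows "times_differentiable_on n S f \<Longrightarrow> times_differentiable_on n T g
    \<Longrightarrow> times_differentiable_on n S (\<lambda>x. g (f x))"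
proof (induction n arbitrary: g)
  case 0
  then show ?case
    using assms(3) by (auto intro: continuous_on_compose2)
next
  case (Suc n)
  let ?D = "\<lambda>x v. \<Sum>b\<in>Basis. (frechet_derivative f (at x) v \<bullet> b) *\<^sub>R frechet_derivative g (at (f x)) b"
  have D: "((\<lambda>x. g (f x)) has_derivative ?D x) (at x)" if "x \<in> S" for x
  proof -
    have g: "(g has_derivative frechet_derivative g (at (f x))) (at (f x))"
      using that Suc.prems assms(3) by (auto simp: frechet_derivative_works)
    then have lin: "linear (frechet_derivative g (at (f x)))"
      by (rule has_derivative_linear)
    have "frechet_derivative g (at (f x)) (\<Sum>b\<in>Basis. (w \<bullet> b) *\<^sub>R b) =
        (\<Sum>b\<in>Basis. (w \<bullet> b) *\<^sub>R frechet_derivative g (at (f x)) b)" for w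
      by (simp del: euclidean_representation add: linear_sum[OF lin] linear_scale[OF lin])
    note rep = this[unfolded euclidean_representation]
    have "(f has_derivative frechet_derivative f (at x)) (at x)"
      using that Suc.prems by (auto simp: frechet_derivative_works)
    from has_derivative_compose[OF this g] show ?thesis
      by (rule has_derivative_eq_rhs) (rule ext, rule rep)
  qed
  have "times_differentiable_on n S (\<lambda>x. frechet_derivative (\<lambda>x. g (f x)) (at x) v)" for v
  proof (rule times_differentiable_on_cong[OF \<open>open S\<close>])
    show "times_differentiable_on n S (\<lambda>x. ?D x v)"
    proof (intro times_differentiable_on_sum times_differentiable_on_bilinear[OF bounded_bilinear_scaleR]
        \<open>open S\<close>)
      fix b :: 'b
      show "times_differentiable_on n S (\<lambda>x. frechet_derivative f (at x) v \<bullet> b)"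
        by (rule times_differentiable_on_bounded_linear[OF bounded_linear_inner_left])
           (use Suc.prems \<open>open S\<close> in auto)
      show "times_differentiable_on n S (\<lambda>x. frechet_derivative g (at (f x)) b)"
        by (rule Suc.IH) (use Suc.prems times_differentiable_on_Suc_imp in auto)
    qed auto
  qed (simp add: frechet_derivative_at[OF D, symmetric])
  then show ?case
    using D by (auto simp: differentiable_def)
qed

section \<open>Smooth maps and their derivatives\<close>

lemma smooth_on_subset: "smooth_on S f \<Longrightarrow> T \<subseteq> S \<Longrightarrow> smooth_on T f"
  unfolding smooth_on_def using times_differentiable_on_subset by blast

lemma smooth_on_cong: "open S \<Longrightarrow> (\<And>x. x \<in> S \<Longrightarrow> f x = g x) \<Longrightarrow> smooth_on S f \<Longrightarrow> smooth_on S g"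
  unfolding smooth_on_def using times_differentiable_on_cong by blast

lemma smooth_on_bounded_linear:
  "bounded_linear L \<Longrightarrow> open S \<Longrightarrow> smooth_on S f \<Longrightarrow> smooth_on S (\<lambda>x. L (f x))"
  by (simp add: smooth_on_def times_differentiable_on_bounded_linear)

lemma smooth_on_compose:
  fixes f :: "'a::real_normed_vector \<Rightarrow> 'b::euclidean_space"
  shows "open S \<Longrightarrow> open T \<Longrightarrow> f ` S \<subseteq> T \<Longrightarrow> smooth_on S f \<Longrightarrow> smooth_on T g
    \<Longrightarrow> smooth_on S (\<lambda>x. g (f x))"
  by (simp add: smooth_on_def times_differentiable_on_compose)

lemma smooth_on_has_derivative:
  "smooth_on S f \<Longrightarrow> x \<in> S \<Longrightarrow> (f has_derivative frechet_derivative f (at x)) (at x)"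
  unfolding smooth_on_def by (metis frechet_derivative_works times_differentiable_on.simps(2))

lemma smooth_on_frechet_derivative:
  "smooth_on S f \<Longrightarrow> smooth_on S (\<lambda>x. frechet_derivative f (at x) v)"
  unfolding smooth_on_def by (metis times_differentiable_on.simps(2))

lemma smooth_on_continuous_on: "smooth_on S f \<Longrightarrow> continuous_on S f"
  unfolding smooth_on_def by (metis times_differentiable_on.simps(1))

lemma smooth_on_isCont: "smooth_on S f \<Longrightarrow> x \<in> S \<Longrightarrow> isCont f x"
  using has_derivative_continuous smooth_on_has_derivative by blast

lemma smooth_on_differentiable: "smooth_on S f \<Longrightarrow> x \<in> S \<Longrightarrow> f differentiable at x"
  using differentiable_def smooth_on_has_derivative by blast

lemma bounded_linear_imp_smooth_on:
  assumes "bounded_linear f"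
  shows "smooth_on S f"
proof -
  have "times_differentiable_on n S f" for n
  proof (cases n)
    case 0
    then show ?thesis by (simp add: assms linear_continuous_on)
  next
    case (Suc m)
    have "frechet_derivative f (at x) = f" for x
      using assms bounded_linear_imp_has_derivative frechet_derivative_at by metis
    then show ?thesis
      using Suc assms
      by (auto simp: times_differentiable_on_const bounded_linear_imp_differentiable)
  qed
  then show ?thesis by (simp add: smooth_on_def)
qed

lemma has_vector_derivative_vector_derivative_smooth:
  "smooth_on S x \<Longrightarrow> t \<in> S \<Longrightarrow> (x has_vector_derivative vector_derivative x (at t)) (at t)"
  by (meson differentiable_def smooth_on_has_derivative vector_derivative_works)

text \<open>The vector derivative is the Frechet derivative in the fixed direction 1.\<close>

lemma smooth_on_vector_derivative:
  assumes "open S" "smooth_on S x"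
  shows "smooth_on S (\<lambda>t. vector_derivative x (at t))"
proof (rule smooth_on_cong[OF \<open>open S\<close> _ smooth_on_frechet_derivative[OF assms(2), of 1]])
  fix t assume "t \<in> S"
  then show "frechet_derivative x (at t) 1 = vector_derivative x (at t)"
    using has_vector_derivative_vector_derivative_smooth[OF assms(2)] frechet_derivative_at
    unfolding has_vector_derivative_def by (metis scaleR_one)
qed

lemma has_vector_derivative_compose_has_derivative:
  assumes "(x has_vector_derivative v) (at t)" "(F has_derivative F') (at (x t))"
  shows "((\<lambda>s. F (x s)) has_vector_derivative F' v) (at t)"
  using has_derivative_compose[OF assms(1)[unfolded has_vector_derivative_def] assms(2)]
    linear_scale[OF has_derivative_linear[OF assms(2)]]
  by (simp add: has_vector_derivative_def)

section \<open>Diffeomorphisms\<close>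

text \<open>Chain rule for the inverse after \<open>h\<close>, which is the identity on the open set
  \<open>S\<close>; this yields injectivity of the derivative.\<close>

lemma diffeomorphism_on_derivative_inverse:
  assumes "diffeomorphism_on S h" "x \<in> S"
  shows "frechet_derivative (inv_into S h) (at (h x)) (frechet_derivative h (at x) v) = v"
proof -
  have "((\<lambda>x. inv_into S h (h x)) has_derivative
      (\<lambda>v. frechet_derivative (inv_into S h) (at (h x)) (frechet_derivative h (at x) v))) (at x)"
    by (rule has_derivative_compose[OF smooth_on_has_derivative[of S]
          smooth_on_has_derivative[of "h ` S"]])
       (use assms in \<open>auto simp: diffeomorphism_on_def\<close>)
  moreover have "((\<lambda>x. inv_into S h (h x)) has_derivative (\<lambda>v. v)) (at x)"
    by (rule has_derivative_transform_within_open[OF has_derivative_ident, of S])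
       (use assms in \<open>auto simp: diffeomorphism_on_def\<close>)
  ultimately show ?thesis
    by (metis has_derivative_unique)
qed

text \<open>The inverse of the inverse agrees with \<open>h\<close> on \<open>S\<close>, and its
  smoothness is transferred along this equality.\<close>

lemma diffeomorphism_on_inv_into:
  assumes "diffeomorphism_on S h"
  shows "diffeomorphism_on (h ` S) (inv_into S h)"
proof -
  have im: "inv_into S h ` h ` S = S"
    using assms by (force simp: diffeomorphism_on_def)
  have "smooth_on S (inv_into (h ` S) (inv_into S h))"
  proof (rule smooth_on_cong[of _ h])
    fix x assume "x \<in> S"
    have "inj_on (inv_into S h) (h ` S)"
      by (simp add: inj_on_inv_into)
    then have "inv_into (h ` S) (inv_into S h) (inv_into S h (h x)) = h x"
      using \<open>x \<in> S\<close> by (simp add: inv_into_f_f)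
    then show "h x = inv_into (h ` S) (inv_into S h) x"
      using assms \<open>x \<in> S\<close> by (simp add: diffeomorphism_on_def)
  qed (use assms in \<open>auto simp: diffeomorphism_on_def\<close>)
  then show ?thesis
    using assms im by (auto simp: diffeomorphism_on_def inj_on_inv_into)
qed

text \<open>Chain rule for the other composition, \<open>h\<close> after its inverse; this yields
  surjectivity of the derivative.\<close>

lemma diffeomorphism_on_inverse_derivative:
  assumes "diffeomorphism_on S h" "x \<in> S"
  shows "frechet_derivative h (at x) (frechet_derivative (inv_into S h) (at (h x)) v) = v"
proof -
  have "((\<lambda>y. h (inv_into S h y)) has_derivative
      (\<lambda>v. frechet_derivative h (at x) (frechet_derivative (inv_into S h) (at (h x)) v))) (at (h x))"
    using has_derivative_compose[OF smooth_on_has_derivative[of "h ` S" "inv_into S h" "h x"]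
        smooth_on_has_derivative[of S h "inv_into S h (h x)"]] assms
    by (auto simp: diffeomorphism_on_def)
  moreover have "((\<lambda>y. h (inv_into S h y)) has_derivative (\<lambda>v. v)) (at (h x))"
    by (rule has_derivative_transform_within_open[OF has_derivative_ident, of "h ` S"])
       (use assms in \<open>auto simp: diffeomorphism_on_def f_inv_into_f\<close>)
  ultimately show ?thesis
    by (metis has_derivative_unique)
qed

lemma diffeomorphism_on_linear:
  assumes "diffeomorphism_on S h" "x \<in> S"
  shows "linear (frechet_derivative h (at x))"
  using assms by (meson diffeomorphism_on_def has_derivative_linear smooth_on_has_derivative)

text \<open>The image of \<open>T\<close> is open because it is the preimage of \<open>T\<close>
  under the continuous inverse; on this image \<open>inv_into T h\<close> and
  \<open>inv_into S h\<close> agree.\<close>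

lemma diffeomorphism_on_subset:
  assumes h: "diffeomorphism_on S h" and T: "open T" "T \<subseteq> S"
  shows "diffeomorphism_on T h"
proof -
  have inv: "inv_into T h (h x) = x" "inv_into S h (h x) = x" if "x \<in> T" for x
    using h T that by (auto simp: diffeomorphism_on_def intro: inv_into_f_f inj_on_subset)
  have "open (h ` S \<inter> inv_into S h -` T)"
    using h T by (intro continuous_open_preimage smooth_on_continuous_on) (auto simp: diffeomorphism_on_def)
  moreover have "h ` S \<inter> inv_into S h -` T = h ` T"
    using h T inv by (auto simp: diffeomorphism_on_def image_iff subset_eq)
  ultimately have "open (h ` T)" by simp
  moreover have "smooth_on (h ` T) (inv_into T h)"
    by (rule smooth_on_cong[OF \<open>open (h ` T)\<close>, of "inv_into S h"])
       (use h T inv in \<open>auto simp: diffeomorphism_on_def intro: smooth_on_subset\<close>)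
  ultimately show ?thesis
    using h T by (auto simp: diffeomorphism_on_def intro: smooth_on_subset inj_on_subset)
qed

lemma diffeomorphism_on_compose:
  fixes h :: "'a::euclidean_space \<Rightarrow> 'b::euclidean_space"
  assumes h: "diffeomorphism_on S h" and k: "diffeomorphism_on T k" and sub: "h ` S \<subseteq> T"
  shows "diffeomorphism_on S (\<lambda>x. k (h x))"
proof -
  have k': "diffeomorphism_on (h ` S) k"
    using diffeomorphism_on_subset[OF k _ sub] h by (simp add: diffeomorphism_on_def)
  then have opn: "open ((\<lambda>x. k (h x)) ` S)"
    by (simp add: diffeomorphism_on_def image_image)
  have inj: "inj_on (\<lambda>x. k (h x)) S"
    using h k' by (auto simp: diffeomorphism_on_def inj_on_def)
  have "smooth_on ((\<lambda>x. k (h x)) ` S) (inv_into S (\<lambda>x. k (h x)))"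
  proof (rule smooth_on_cong[OF opn])
    show "smooth_on ((\<lambda>x. k (h x)) ` S) (\<lambda>z. inv_into S h (inv_into (h ` S) k z))"
      by (rule smooth_on_compose[OF opn, of "h ` S"])
         (use h k' in \<open>auto simp: diffeomorphism_on_def image_image\<close>)
    show "inv_into S h (inv_into (h ` S) k z) = inv_into S (\<lambda>x. k (h x)) z"
      if z: "z \<in> (\<lambda>x. k (h x)) ` S" for z
    proof -
      obtain x where x: "x \<in> S" "z = k (h x)" using z by blast
      have "inv_into (h ` S) k z = h x" "inv_into S h (h x) = x"
        using h k' x by (simp_all add: diffeomorphism_on_def)
      then show ?thesis using inv_into_f_f[OF inj x(1)] x(2) by simp
    qed
  qed
  moreover have "smooth_on S (\<lambda>x. k (h x))"
    by (rule smooth_on_compose[of S T]) (use h k sub in \<open>auto simp: diffeomorphism_on_def\<close>)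
  ultimately show ?thesis
    using h opn inj by (simp add: diffeomorphism_on_def)
qed

section \<open>Estimates and identities\<close>

text \<open>The mean value theorem gives \<open>h z - h 0 = h' (\<theta> * z) * z\<close>, and
  \<open>h'\<close> is linear near 0 up to a small error. Main term and error carry the same unknown
  factor \<open>\<theta>\<close>, so the sign of \<open>d\<close> controls the sign of
  \<open>h z - h 0\<close> once \<open>\<epsilon> \<le> \<bar>d\<bar>\<close>.\<close>

lemma second_order_bound:
  fixes h h' :: "real \<Rightarrow> real"
  assumes "r > 0" and h: "\<And>z. \<bar>z\<bar> < r \<Longrightarrow> (h has_real_derivative h' z) (at z)"
    and h': "(h' has_real_derivative d) (at 0)" "h' 0 = 0" and "\<epsilon> > 0"
  shows "\<exists>\<rho>>0. \<forall>z. \<bar>z\<bar> < \<rho> \<longrightarrow>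
    (\<exists>\<theta>. 0 \<le> \<theta> \<and> \<theta> \<le> 1 \<and> \<bar>h z - h 0 - \<theta> * d * z\<^sup>2\<bar> \<le> \<theta> * \<epsilon> * z\<^sup>2)"
proof -
  obtain \<delta> where "\<delta> > 0" and \<delta>: "\<And>y. \<bar>y\<bar> < \<delta> \<Longrightarrow> \<bar>h' y - d * y\<bar> \<le> \<epsilon> * \<bar>y\<bar>"
    using h' \<open>\<epsilon> > 0\<close>
    unfolding has_field_derivative_def has_derivative_at_alt by (metis diff_zero real_norm_def)
  have "\<exists>\<theta>. 0 \<le> \<theta> \<and> \<theta> \<le> 1 \<and> \<bar>h z - h 0 - \<theta> * d * z\<^sup>2\<bar> \<le> \<theta> * \<epsilon> * z\<^sup>2"
    if z: "\<bar>z\<bar> < min r \<delta>" for z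
  proof -
    \<comment> \<open>Running along the segment from 0 to \<open>z\<close> with a parameter in the
      unit interval treats both signs of \<open>z\<close> at once.\<close>
    have k: "((\<lambda>t. h (t * z)) has_real_derivative h' (t * z) * z) (at t)" if "0 \<le> t" "t \<le> 1" for t
    proof -
      have "\<bar>t * z\<bar> \<le> \<bar>z\<bar>" using that by (simp add: abs_mult mult_left_le_one_le)
      then have "(h has_real_derivative h' (t * z)) (at (t * z))" using z h by auto
      moreover have "((\<lambda>t. t * z) has_real_derivative z) (at t)" by (auto intro!: derivative_eq_intros)
      ultimately show ?thesis by (rule DERIV_chain2)
    qed
    obtain \<theta> where \<theta>: "0 < \<theta>" "\<theta> < 1" "h (1 * z) - h (0 * z) = (1 - 0) * (h' (\<theta> * z) * z)"
      using MVT2[of 0 1 "\<lambda>t. h (t * z)" "\<lambda>t. h' (t * z) * z"] k by auto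
    have "\<bar>\<theta> * z\<bar> \<le> \<bar>z\<bar>" using \<theta> by (simp add: abs_mult mult_left_le_one_le)
    then have "\<bar>h' (\<theta> * z) - d * (\<theta> * z)\<bar> \<le> \<epsilon> * \<bar>\<theta> * z\<bar>" using \<delta> z by auto
    then have "\<bar>h' (\<theta> * z) - d * (\<theta> * z)\<bar> * \<bar>z\<bar> \<le> \<epsilon> * \<bar>\<theta> * z\<bar> * \<bar>z\<bar>"
      by (rule mult_right_mono) simp
    then have "\<bar>(h' (\<theta> * z) - d * (\<theta> * z)) * z\<bar> \<le> \<theta> * \<epsilon> * z\<^sup>2"
      using \<theta> by (simp add: abs_mult power2_eq_square ac_simps abs_mult_self_eq)
    moreover have "(h' (\<theta> * z) - d * (\<theta> * z)) * z = h z - h 0 - \<theta> * d * z\<^sup>2"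
      using \<theta>(3) by (simp add: algebra_simps power2_eq_square)
    ultimately show ?thesis using \<theta> by (intro exI[of _ \<theta>]) auto
  qed
  then show ?thesis using \<open>r > 0\<close> \<open>\<delta> > 0\<close> by (intro exI[of _ "min r \<delta>"]) auto
qed

section \<open>Determinants, Gram identities and derivatives of unit vectors\<close>

lemma det3_expand:
  "det3 a b c = a$1 * b$2 * c$3 + a$2 * b$3 * c$1 + a$3 * b$1 * c$2
     - a$1 * b$3 * c$2 - a$2 * b$1 * c$3 - a$3 * b$2 * c$1"
  by (simp add: det3_def det_3)

lemma det3_scaleR:
  "det3 (k *\<^sub>R a) b c = k * det3 a b c" "det3 a (k *\<^sub>R b) c = k * det3 a b c"
  by (simp_all add: det3_expand algebra_simps)

lemma det3_swap: "det3 b a c = - det3 a b c"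
  by (simp add: det3_expand algebra_simps)

lemma det3_linear_combination:
  "det3 (k *\<^sub>R a + l *\<^sub>R b) (m *\<^sub>R a + n *\<^sub>R b) c = (k * n - l * m) * det3 a b c"
  by (simp add: det3_expand algebra_simps)

lemma det2_expand: "det2 a b = a$1 * b$2 - a$2 * b$1"
  by (simp add: det2_def det_2)

text \<open>The right-hand side is the expanded determinant of the 3 by 3 matrix of inner
  products.\<close>

lemma det3_mult_det3:
  "det3 a b c * det3 d e f =
     (a \<bullet> d) * (b \<bullet> e) * (c \<bullet> f) + (a \<bullet> e) * (b \<bullet> f) * (c \<bullet> d) + (a \<bullet> f) * (b \<bullet> d) * (c \<bullet> e)
     - (a \<bullet> d) * (b \<bullet> f) * (c \<bullet> e) - (a \<bullet> e) * (b \<bullet> d) * (c \<bullet> f) - (a \<bullet> f) * (b \<bullet> e) * (c \<bullet> d)"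
  unfolding det3_expand inner_vec_def sum_3 inner_real_def by algebra

text \<open>In the Gram matrix of \<open>(y, a, n)\<close> against \<open>(y, q, n)\<close> the last
  column is \<open>(0, 0, 1)\<close>, so a 2 by 2 determinant remains.\<close>

lemma det3_mult_det3_unit_normal:
  assumes "norm n = 1" "a \<bullet> n = 0" "y \<bullet> n = 0"
  shows "det3 y a n * det3 y q n = (y \<bullet> y) * (a \<bullet> q) - (y \<bullet> q) * (a \<bullet> y)"
  using assms by (simp add: det3_mult_det3 dot_square_norm inner_commute)

lemma differentiable_vec_nth:
  "f differentiable at x \<Longrightarrow> (\<lambda>x. f x $ i) differentiable at x"
  unfolding differentiable_def using bounded_linear.has_derivative[OF bounded_linear_vec_nth] by blast

lemma differentiable_det3:
  assumes "f differentiable at x" "g differentiable at x" "h differentiable at x"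
  shows "(\<lambda>x. det3 (f x) (g x) (h x)) differentiable at x"
  unfolding det3_expand
  by (intro differentiable_add differentiable_diff differentiable_mult differentiable_vec_nth assms)

lemma differentiable_det2:
  assumes "f differentiable at x" "g differentiable at x"
  shows "(\<lambda>x. det2 (f x) (g x)) differentiable at x"
  unfolding det2_expand
  by (intro differentiable_diff differentiable_mult differentiable_vec_nth assms)

lemma continuous_det3:
  assumes "continuous F f" "continuous F g" "continuous F h"
  shows "continuous F (\<lambda>x. det3 (f x) (g x) (h x))"
  unfolding det3_expand by (intro continuous_intros assms)

text \<open>Only the component of \<open>y'\<close> orthogonal to \<open>y\<close> turns the
  direction of \<open>y\<close>.\<close>

lemma has_vector_derivative_sgn:
  fixes y :: "real \<Rightarrow> 'a::real_inner"
  assumes "(y has_vector_derivative y') (at t)" "y t \<noteq> 0"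
  shows "((\<lambda>s. sgn (y s)) has_vector_derivative
    (1 / norm (y t)) *\<^sub>R (y' - ((y t \<bullet> y') / (y t \<bullet> y t)) *\<^sub>R y t)) (at t)"
proof -
  have y: "(y has_derivative (\<lambda>s. s *\<^sub>R y')) (at t)"
    using assms(1) by (simp add: has_vector_derivative_def)
  have N: "((\<lambda>s. norm (y s)) has_derivative (\<lambda>s. (s *\<^sub>R y') \<bullet> sgn (y t))) (at t)"
    using has_derivative_compose[OF y has_derivative_norm[OF assms(2)]] by simp
  have "((\<lambda>s. inverse (norm (y s))) has_derivative
      (\<lambda>s. - (inverse (norm (y t)) * ((s *\<^sub>R y') \<bullet> sgn (y t)) * inverse (norm (y t))))) (at t)"
    by (rule Deriv.has_derivative_inverse[OF _ N]) (use assms(2) in simp)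
  from has_derivative_scaleR[OF this y]
  have "((\<lambda>s. sgn (y s)) has_derivative
     (\<lambda>s. inverse (norm (y t)) *\<^sub>R (s *\<^sub>R y') +
        (- (inverse (norm (y t)) * ((s *\<^sub>R y') \<bullet> sgn (y t)) * inverse (norm (y t)))) *\<^sub>R y t)) (at t)"
    by (simp add: sgn_div_norm)
  then show ?thesis
    unfolding has_vector_derivative_def
    by (rule has_derivative_eq_rhs)
       (use assms(2) in \<open>auto simp: fun_eq_iff sgn_div_norm scaleR_diff_right inner_commute
          dot_square_norm power2_eq_square field_simps\<close>)
qed

section \<open>The standard cuspidal edge\<close>

definition cusp_map :: "real^2 \<Rightarrow> real^3" where
  "cusp_map w = vector [(w $ 1)^2, (w $ 1)^3, w $ 2]"

lemma vector_3_axis: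
  "(vector [x, y, z] :: real^3) = x *\<^sub>R axis 1 1 + y *\<^sub>R axis 2 1 + z *\<^sub>R axis 3 1"
  by (simp add: vec_eq_iff forall_3 axis_def)

lemma vec2_axis: "(w :: real^2) = w$1 *\<^sub>R axis 1 1 + w$2 *\<^sub>R axis 2 1"
  by (simp add: vec_eq_iff forall_2 axis_def)

lemma axis_2_nth [simp]:
  "(axis 1 1 :: real^2) $ 1 = 1" "(axis 1 1 :: real^2) $ 2 = 0"
  "(axis 2 1 :: real^2) $ 1 = 0" "(axis 2 1 :: real^2) $ 2 = 1"
  by (simp_all add: axis_def)

lemma has_derivative_cusp_map:
  "(cusp_map has_derivative (\<lambda>v. vector [2 * w$1 * v$1, 3 * (w$1)^2 * v$1, v$2])) (at w)"
  unfolding cusp_map_def[abs_def] vector_3_axis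
  by (auto intro!: derivative_eq_intros bounded_linear_imp_has_derivative bounded_linear_vec_nth
      simp: algebra_simps)

lemma cusp_map_0 [simp]: "cusp_map 0 = 0"
  by (simp add: cusp_map_def vec_eq_iff forall_3)

text \<open>The derivative in the direction \<open>(u\<^sup>2, u\<^sup>3, 0)\<close> is \<open>u\<^sup>2\<close> times a function that is positive
  near the origin.\<close>

lemma cusp_map_half_space:
  fixes \<Psi> :: "real^3 \<Rightarrow> real^3"
  assumes "open T" "0 \<in> T" "smooth_on T \<Psi>"
    and pos: "n \<bullet> frechet_derivative \<Psi> (at 0) (axis 1 1) > 0"
  shows "\<exists>\<rho>>0. \<exists>c>0. \<forall>w. norm w < \<rho> \<longrightarrow>
    c * (w$1)\<^sup>2 \<le> n \<bullet> (\<Psi> (cusp_map w) - \<Psi> (w$2 *\<^sub>R axis 3 1))"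
proof -
  define A where "A = (\<lambda>z. n \<bullet> frechet_derivative \<Psi> (at z) (axis 1 1))"
  define B where "B = (\<lambda>z. n \<bullet> frechet_derivative \<Psi> (at z) (axis 2 1))"
  define K where "K = \<bar>B 0\<bar> + 1"
  have "isCont A 0" "isCont B 0"
    unfolding A_def B_def
    by (auto intro!: isCont_inner smooth_on_isCont[OF smooth_on_frechet_derivative[OF assms(3)] assms(2)])
  then have lim: "(A \<longlongrightarrow> A 0) (nhds 0)" "((\<lambda>z. \<bar>B z\<bar>) \<longlongrightarrow> \<bar>B 0\<bar>) (nhds 0)"
    by (simp_all add: isCont_def tendsto_at_iff_tendsto_nhds tendsto_rabs)
  have "A 0 / 2 < A 0" "\<bar>B 0\<bar> < K" using pos by (simp_all add: A_def K_def)
  then have "\<forall>\<^sub>F z in nhds 0. A z > A 0 / 2" "\<forall>\<^sub>F z in nhds 0. \<bar>B z\<bar> < K"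
    using order_tendstoD(1)[OF lim(1)] order_tendstoD(2)[OF lim(2)] by blast+
  moreover have "\<forall>\<^sub>F z in nhds 0. z \<in> T"
    using assms eventually_nhds by blast
  ultimately have "\<forall>\<^sub>F z in nhds 0. z \<in> T \<and> A z > A 0 / 2 \<and> \<bar>B z\<bar> < K"
    by eventually_elim auto
  then obtain r where "r > 0" and r: "\<And>z. norm z < r \<Longrightarrow> z \<in> T \<and> A z > A 0 / 2 \<and> \<bar>B z\<bar> < K"
    by (auto simp: eventually_nhds_metric)
  \<comment> \<open>The bound 1 gives \<open>u\<^sup>2 \<le> \<bar>u\<bar>\<close> and
    \<open>\<bar>u\<bar>^3 \<le> \<bar>u\<bar>\<close>, \<open>r / 3\<close> keeps the segment below
    in the ball of radius \<open>r\<close>, and \<open>A 0 / (4 * K)\<close> makes the cubic term at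
    most \<open>A 0 / 4\<close>, half of the lower bound for \<open>A\<close>.\<close>
  define \<rho> where "\<rho> = min (min 1 (r / 3)) (A 0 / (4 * K))"
  have "K > 0" "A 0 > 0" using pos by (auto simp: K_def A_def)
  have "\<rho> > 0" using \<open>r > 0\<close> \<open>K > 0\<close> \<open>A 0 > 0\<close> by (simp add: \<rho>_def)
  moreover have "A 0 / 4 * (w$1)\<^sup>2 \<le> n \<bullet> (\<Psi> (cusp_map w) - \<Psi> (w$2 *\<^sub>R axis 3 1))"
    if "norm w < \<rho>" for w
  proof -
    define u v where "u = w$1" and "v = w$2"
    have uv: "\<bar>u\<bar> < \<rho>" "\<bar>v\<bar> < \<rho>"
      using that component_le_norm_cart[of w 1] component_le_norm_cart[of w 2] by (auto simp: u_def v_def)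
    \<comment> \<open>The segment \<open>?z\<close> runs from the point of the singular axis with
      the same \<open>v\<close> to \<open>cusp_map w\<close>.\<close>
    let ?d = "u\<^sup>2 *\<^sub>R axis 1 1 + u^3 *\<^sub>R axis 2 1 :: real^3"
    let ?z = "\<lambda>t. v *\<^sub>R axis 3 1 + t *\<^sub>R ?d"
    have "\<bar>u\<bar> \<le> 1" using uv by (simp add: \<rho>_def)
    then have u23: "u\<^sup>2 \<le> \<bar>u\<bar>" "\<bar>u\<bar>^3 \<le> \<bar>u\<bar>"
      using power_decreasing[of 1 2 "\<bar>u\<bar>"] power_decreasing[of 1 3 "\<bar>u\<bar>"] by auto
    have z: "norm (?z t) < r" if "0 \<le> t" "t \<le> 1" for t
    proof -
      have "norm (?z t) \<le> norm (v *\<^sub>R axis 3 1 :: real^3) + \<bar>t\<bar> * norm ?d"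
        using norm_triangle_ineq[of "v *\<^sub>R axis 3 1" "t *\<^sub>R ?d"] by simp
      also have "\<dots> \<le> \<bar>v\<bar> + 1 * (\<bar>u\<bar> + \<bar>u\<bar>)"
      proof (intro add_mono mult_mono)
        show "norm ?d \<le> \<bar>u\<bar> + \<bar>u\<bar>"
          using norm_triangle_ineq[of "u\<^sup>2 *\<^sub>R axis 1 1 :: real^3" "u^3 *\<^sub>R axis 2 1"] u23
          by (simp add: power_abs)
      qed (use that in auto)
      also have "\<dots> < r" using uv by (simp add: \<rho>_def)
      finally show ?thesis .
    qed
    have D: "((\<lambda>t. n \<bullet> \<Psi> (?z t)) has_real_derivative u\<^sup>2 * (A (?z t) + u * B (?z t))) (at t)"
      if "0 \<le> t" "t \<le> 1" for t
    proof -
      have zv: "(?z has_vector_derivative ?d) (at t)"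
        by (auto intro!: derivative_eq_intros)
      have \<Psi>: "(\<Psi> has_derivative frechet_derivative \<Psi> (at (?z t))) (at (?z t))"
        using smooth_on_has_derivative[OF assms(3)] r[OF z[OF that]] by blast
      note lin = has_derivative_linear[OF \<Psi>]
      have "((\<lambda>t. n \<bullet> \<Psi> (?z t)) has_vector_derivative
          n \<bullet> frechet_derivative \<Psi> (at (?z t)) ?d) (at t)"
        by (rule bounded_linear.has_vector_derivative[OF bounded_linear_inner_right
              has_vector_derivative_compose_has_derivative[OF zv \<Psi>]])
      moreover have "n \<bullet> frechet_derivative \<Psi> (at (?z t)) ?d = u\<^sup>2 * (A (?z t) + u * B (?z t))"
        unfolding A_def B_def linear_add[OF lin] linear_scale[OF lin]
        by (simp add: inner_add_right algebra_simps power2_eq_square power3_eq_cube)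
      ultimately show ?thesis by (simp add: has_real_derivative_iff_has_vector_derivative)
    qed
    obtain t where t: "0 < t" "t < 1"
      "n \<bullet> \<Psi> (?z 1) - n \<bullet> \<Psi> (?z 0) = (1 - 0) * (u\<^sup>2 * (A (?z t) + u * B (?z t)))"
      using MVT2[of 0 1 "\<lambda>t. n \<bullet> \<Psi> (?z t)" "\<lambda>t. u\<^sup>2 * (A (?z t) + u * B (?z t))"] D by auto
    have "\<bar>u * B (?z t)\<bar> \<le> \<bar>u\<bar> * K"
      using r[OF z[of t]] t by (simp add: abs_mult mult_left_mono)
    also have "\<dots> \<le> A 0 / 4"
      using uv(1) \<open>K > 0\<close> by (simp add: \<rho>_def field_simps)
    finally have "A 0 / 4 \<le> A (?z t) + u * B (?z t)"
      using r[OF z[of t]] t by (auto simp: abs_le_iff)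
    then have "u\<^sup>2 * (A 0 / 4) \<le> u\<^sup>2 * (A (?z t) + u * B (?z t))"
      by (rule mult_left_mono) simp
    moreover have "?z 1 = cusp_map w" by (simp add: cusp_map_def vector_3_axis u_def v_def algebra_simps)
    ultimately show ?thesis
      using t(3) by (simp add: inner_diff_right u_def v_def algebra_simps)
  qed
  ultimately show ?thesis using \<open>A 0 > 0\<close> by (intro exI[of _ \<rho>] conjI exI[of _ "A 0 / 4"]) auto
qed

text \<open>Divided by \<open>s\<close>, the first coordinate tends to
  \<open>\<alpha> \<noteq> 0\<close> and the second to 0. Hence the second coordinate is negligible
  against the first, whatever the constants \<open>C\<close> and \<open>c\<close>.\<close>

lemma curve_tangent_to_first_axis:
  fixes w :: "real \<Rightarrow> real^2"
  assumes "(w has_vector_derivative \<alpha> *\<^sub>R axis 1 1) (at 0)" "w 0 = 0" "\<alpha> \<noteq> 0" "c > 0"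
  shows "\<forall>\<^sub>F s in nhds 0. C * (w s $ 2)\<^sup>2 \<le> c * (w s $ 1)\<^sup>2"
proof -
  have "((\<lambda>s. w s $ i) has_real_derivative (\<alpha> *\<^sub>R axis 1 1 :: real^2) $ i) (at 0)" for i
    using bounded_linear.has_vector_derivative[OF bounded_linear_vec_nth assms(1)]
    by (simp add: has_real_derivative_iff_has_vector_derivative)
  from this[of 1] this[of 2] have "(\<lambda>s. w s $ 1 / s) \<midarrow>0\<rightarrow> \<alpha>" "(\<lambda>s. w s $ 2 / s) \<midarrow>0\<rightarrow> 0"
    using \<open>w 0 = 0\<close> by (simp_all add: DERIV_def axis_def)
  then have "(\<lambda>s. C * (w s $ 2 / s)\<^sup>2 - c * (w s $ 1 / s)\<^sup>2) \<midarrow>0\<rightarrow> C * 0\<^sup>2 - c * \<alpha>\<^sup>2"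
    by (intro tendsto_intros)
  then have "\<forall>\<^sub>F s in at 0. C * (w s $ 2 / s)\<^sup>2 - c * (w s $ 1 / s)\<^sup>2 < 0"
    by (rule order_tendstoD) (use assms in simp)
  then have "\<forall>\<^sub>F s in at 0. C * (w s $ 2)\<^sup>2 \<le> c * (w s $ 1)\<^sup>2"
    using eventually_neq_at_within[of 0 0]
    by eventually_elim (auto simp: power_divide divide_less_0_iff zero_less_power2 simp flip: diff_divide_distrib)
  \<comment> \<open>The division excluded \<open>s = 0\<close>, where both sides vanish.\<close>
  then show ?thesis
    unfolding eventually_at_filter
  proof (rule eventually_mono)
    fix s assume "s \<noteq> 0 \<longrightarrow> s \<in> UNIV \<longrightarrow> C * (w s $ 2)\<^sup>2 \<le> c * (w s $ 1)\<^sup>2"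
    then show "C * (w s $ 2)\<^sup>2 \<le> c * (w s $ 1)\<^sup>2"
      using \<open>w 0 = 0\<close> by (cases "s = 0") auto
  qed
qed

section \<open>A front in a chart around a cuspidal edge\<close>

text \<open>A purely Euclidean setting: \<open>F\<close> and \<open>N\<close> are the front and its
  unit normal read in one chart with coordinate range \<open>D\<close>, while \<open>\<phi>\<close>
  and \<open>\<Phi>\<close> bring \<open>F\<close> to the standard cuspidal edge.\<close>

locale cuspidal_edge_chart =
  fixes F N :: "real^2 \<Rightarrow> real^3" and D W :: "(real^2) set" and \<phi> :: "real^2 \<Rightarrow> real^2"
    and V :: "(real^3) set" and \<Phi> :: "real^3 \<Rightarrow> real^3"
  assumes smooth_F: "smooth_on D F" and smooth_N: "smooth_on D N"
    and norm_N: "\<And>x. x \<in> D \<Longrightarrow> norm (N x) = 1"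
    and normal: "\<And>x v. x \<in> D \<Longrightarrow> frechet_derivative F (at x) v \<bullet> N x = 0"
    and diffeo_\<phi>: "diffeomorphism_on W \<phi>" and zero_in_W: "0 \<in> W" and \<phi>_in_D: "\<phi> ` W \<subseteq> D"
    and diffeo_\<Phi>: "diffeomorphism_on V \<Phi>" and F_\<phi>_in_V: "F ` \<phi> ` W \<subseteq> V"
    and \<Phi>_F_\<phi>: "\<And>w. w \<in> W \<Longrightarrow> \<Phi> (F (\<phi> w)) = cusp_map w"
begin

text \<open>The coordinates \<open>(u, v)\<close> of the normal form; \<open>\<psi>\<close> below
  parametrizes the image of the singular set \<open>u = 0\<close> by \<open>v\<close>.\<close>

definition \<xi> where "\<xi> = inv_into W \<phi>"
definition \<Psi> where "\<Psi> = inv_into V \<Phi>"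
definition T where "T = \<Phi> ` V"
definition \<psi> where "\<psi> z = \<Psi> (z *\<^sub>R axis 3 1)"
definition a where "a = frechet_derivative \<Psi> (at 0) (axis 1 1)"
definition b where "b = frechet_derivative \<Psi> (at 0) (axis 3 1)"
definition q where "q = vector_derivative (\<lambda>z. vector_derivative \<psi> (at z)) (at 0)"
definition d\<phi> where "d\<phi> w = frechet_derivative \<phi> (at w)"

section \<open>Derivatives in the coordinates of the normal form\<close>

lemma open_W: "open W" and open_\<phi>_W: "open (\<phi> ` W)" and smooth_\<phi>: "smooth_on W \<phi>"
  and smooth_\<xi>: "smooth_on (\<phi> ` W) \<xi>"
  using diffeo_\<phi> by (auto simp: diffeomorphism_on_def \<xi>_def)

lemma \<xi>_\<phi> [simp]: "w \<in> W \<Longrightarrow> \<xi> (\<phi> w) = w"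
  using diffeo_\<phi> by (simp add: \<xi>_def diffeomorphism_on_def)

lemma \<phi>_\<xi>: "x \<in> \<phi> ` W \<Longrightarrow> \<phi> (\<xi> x) = x" and \<xi>_in_W: "x \<in> \<phi> ` W \<Longrightarrow> \<xi> x \<in> W"
  by auto

lemma diffeo_\<Psi>: "diffeomorphism_on T \<Psi>"
  using diffeomorphism_on_inv_into[OF diffeo_\<Phi>] by (simp add: \<Psi>_def T_def)

lemma open_T: "open T" and smooth_\<Psi>: "smooth_on T \<Psi>"
  using diffeo_\<Psi> by (auto simp: diffeomorphism_on_def)

lemma cusp_in_T: "w \<in> W \<Longrightarrow> cusp_map w \<in> T"
  using F_\<phi>_in_V \<Phi>_F_\<phi> unfolding T_def by force

lemma F_\<phi>: "w \<in> W \<Longrightarrow> F (\<phi> w) = \<Psi> (cusp_map w)"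
  using inv_into_f_f[of \<Phi> V "F (\<phi> w)"] F_\<phi>_in_V diffeo_\<Phi>
  by (simp add: \<Psi>_def diffeomorphism_on_def image_subset_iff \<Phi>_F_\<phi>)

lemma zero_in_T: "0 \<in> T"
  using cusp_in_T[OF zero_in_W] by simp

lemma d\<Psi>_inj: "z \<in> T \<Longrightarrow> frechet_derivative \<Psi> (at z) v = 0 \<Longrightarrow> v = 0"
  using diffeomorphism_on_derivative_inverse[OF diffeo_\<Psi>, of z v]
    diffeomorphism_on_linear[OF diffeomorphism_on_inv_into[OF diffeo_\<Psi>], of "\<Psi> z"]
  by (auto simp: linear_0)

lemma linear_d\<Psi>: "z \<in> T \<Longrightarrow> linear (frechet_derivative \<Psi> (at z))"
  using diffeomorphism_on_linear diffeo_\<Psi> by blast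

lemma linear_d\<phi>: "w \<in> W \<Longrightarrow> linear (d\<phi> w)"
  unfolding d\<phi>_def using diffeomorphism_on_linear diffeo_\<phi> by blast

lemma linear_dF: "x \<in> D \<Longrightarrow> linear (frechet_derivative F (at x))"
  using smooth_on_has_derivative[OF smooth_F] has_derivative_linear by blast

lemma d\<phi>_d\<xi>: "w \<in> W \<Longrightarrow> d\<phi> w (frechet_derivative \<xi> (at (\<phi> w)) v) = v"
  unfolding d\<phi>_def \<xi>_def by (rule diffeomorphism_on_inverse_derivative[OF diffeo_\<phi>])

lemma d\<xi>_d\<phi>: "w \<in> W \<Longrightarrow> frechet_derivative \<xi> (at (\<phi> w)) (d\<phi> w v) = v"
  unfolding d\<phi>_def \<xi>_def by (rule diffeomorphism_on_derivative_inverse[OF diffeo_\<phi>])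

text \<open>Both sides differentiate the same map, once as \<open>F\<close> after
  \<open>\<phi>\<close> and once as \<open>\<Psi>\<close> after \<open>cusp_map\<close>.\<close>

lemma dF_d\<phi>:
  assumes "w \<in> W"
  shows "frechet_derivative F (at (\<phi> w)) (d\<phi> w v) =
    frechet_derivative \<Psi> (at (cusp_map w)) (vector [2 * w$1 * v$1, 3 * (w$1)^2 * v$1, v$2])"
proof -
  have "\<phi> w \<in> D" using assms \<phi>_in_D by blast
  have "((\<lambda>w. F (\<phi> w)) has_derivative (\<lambda>v. frechet_derivative F (at (\<phi> w)) (d\<phi> w v))) (at w)"
    unfolding d\<phi>_def
    by (rule has_derivative_compose[OF smooth_on_has_derivative[OF smooth_\<phi> assms]
          smooth_on_has_derivative[OF smooth_F \<open>\<phi> w \<in> D\<close>]])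
  moreover have "((\<lambda>w. F (\<phi> w)) has_derivative (\<lambda>v. frechet_derivative \<Psi> (at (cusp_map w))
      (vector [2 * w$1 * v$1, 3 * (w$1)^2 * v$1, v$2]))) (at w)"
    by (rule has_derivative_transform_within_open[OF has_derivative_compose[OF has_derivative_cusp_map
          smooth_on_has_derivative[OF smooth_\<Psi> cusp_in_T[OF assms]]] open_W assms])
       (simp add: F_\<phi>)
  ultimately have "(\<lambda>v. frechet_derivative F (at (\<phi> w)) (d\<phi> w v)) = (\<lambda>v. frechet_derivative \<Psi> (at (cusp_map w))
      (vector [2 * w$1 * v$1, 3 * (w$1)^2 * v$1, v$2]))"
    by (rule has_derivative_unique)
  then show ?thesis by (rule fun_cong)
qed

text \<open>The first and third components of the derivative of \<open>cusp_map\<close> already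
  determine the vector when \<open>u \<noteq> 0\<close>. Consequently singular points can only lie
  on the axis \<open>u = 0\<close>.\<close>

lemma inj_dF:
  assumes "w \<in> W" "w $ 1 \<noteq> 0"
  shows "inj (frechet_derivative F (at (\<phi> w)))"
proof -
  have "v = 0" if "frechet_derivative F (at (\<phi> w)) v = 0" for v
  proof -
    define v' where "v' = frechet_derivative \<xi> (at (\<phi> w)) v"
    have v: "v = d\<phi> w v'" by (simp add: v'_def d\<phi>_d\<xi> assms)
    have "(vector [2 * w$1 * v'$1, 3 * (w$1)^2 * v'$1, v'$2] :: real^3) = 0"
      using that d\<Psi>_inj[OF cusp_in_T[OF assms(1)]] by (simp add: v dF_d\<phi> assms(1))
    then have "v' = 0" using assms(2) by (auto simp: vec_eq_iff forall_2 forall_3)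
    then show ?thesis by (simp add: v linear_0[OF linear_d\<phi>[OF assms(1)]])
  qed
  then show ?thesis
    using linear_injective_0 linear_dF \<phi>_in_D assms(1) by blast
qed

lemma \<phi>0_in_D: "\<phi> 0 \<in> D"
  using \<phi>_in_D zero_in_W by blast

lemma dF_d\<phi>_0: "frechet_derivative F (at (\<phi> 0)) (d\<phi> 0 v) = v$2 *\<^sub>R b"
  by (simp add: dF_d\<phi> zero_in_W vector_3_axis b_def linear_scale[OF linear_d\<Psi>[OF zero_in_T]])

lemma b_nonzero: "b \<noteq> 0"
  using d\<Psi>_inj[OF zero_in_T, of "axis 3 1"] by (auto simp: b_def)

text \<open>At the singular point the derivative of \<open>F\<close> is
  \<open>v$2 *\<^sub>R b\<close> with \<open>b \<noteq> 0\<close>, so its kernel is the direction of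
  the first coordinate.\<close>

lemma null_direction:
  assumes "frechet_derivative F (at (\<phi> 0)) v = 0"
  shows "frechet_derivative \<xi> (at (\<phi> 0)) v = (frechet_derivative \<xi> (at (\<phi> 0)) v) $ 1 *\<^sub>R axis 1 1"
    and "v = (frechet_derivative \<xi> (at (\<phi> 0)) v) $ 1 *\<^sub>R d\<phi> 0 (axis 1 1)"
proof -
  define v' where "v' = frechet_derivative \<xi> (at (\<phi> 0)) v"
  have v: "v = d\<phi> 0 v'" by (simp add: v'_def d\<phi>_d\<xi> zero_in_W)
  then have "v' $ 2 = 0" using assms b_nonzero by (simp add: dF_d\<phi>_0)
  then have v': "v' = v' $ 1 *\<^sub>R axis 1 1" using vec2_axis[of v'] by simp
  then show "v' = v' $ 1 *\<^sub>R axis 1 1" .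
  show "v = v' $ 1 *\<^sub>R d\<phi> 0 (axis 1 1)"
    unfolding v linear_scale[OF linear_d\<phi>[OF zero_in_W], symmetric] using v' by simp
qed

text \<open>\<open>d F (d\<phi> e\<^sub>1) = u \<cdot> H u\<close> at the point \<open>\<phi> (u, 0)\<close>; this quotient has a limit
  at the singular point.\<close>

definition H where
  "H u = 2 *\<^sub>R frechet_derivative \<Psi> (at (cusp_map (u *\<^sub>R axis 1 1))) (axis 1 1)
     + (3 * u) *\<^sub>R frechet_derivative \<Psi> (at (cusp_map (u *\<^sub>R axis 1 1))) (axis 2 1)"

lemma isCont_axis: "isCont (\<lambda>u. u *\<^sub>R axis 1 1 :: real^2) 0"
  by (intro continuous_intros)

lemma isCont_d\<Psi>_cusp:
  "isCont (\<lambda>u. frechet_derivative \<Psi> (at (cusp_map (u *\<^sub>R axis 1 1))) v) 0"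
proof -
  have "isCont (\<lambda>u. cusp_map (u *\<^sub>R axis 1 1)) 0"
    by (rule isCont_o2[OF isCont_axis has_derivative_continuous[OF has_derivative_cusp_map]])
  moreover have "isCont (\<lambda>z. frechet_derivative \<Psi> (at z) v) (cusp_map (0 *\<^sub>R axis 1 1))"
    using smooth_on_isCont[OF smooth_on_frechet_derivative[OF smooth_\<Psi>] zero_in_T] by simp
  ultimately show ?thesis by (rule isCont_o2)
qed

lemma isCont_H: "isCont H 0"
  unfolding H_def[abs_def] by (intro continuous_intros isCont_d\<Psi>_cusp)

lemma H_0: "H 0 = 2 *\<^sub>R a"
  by (simp add: H_def a_def)

lemma isCont_N_axis: "isCont (\<lambda>u. N (\<phi> (u *\<^sub>R axis 1 1))) 0"
proof -
  have "isCont (\<lambda>u. \<phi> (u *\<^sub>R axis 1 1)) 0"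
    by (rule isCont_o2[OF isCont_axis]) (simp add: smooth_on_isCont[OF smooth_\<phi> zero_in_W])
  then show ?thesis
    by (rule isCont_o2) (simp add: smooth_on_isCont[OF smooth_N \<phi>0_in_D])
qed

lemma dF_d\<phi>_axis_1:
  assumes "u *\<^sub>R axis 1 1 \<in> W"
  shows "frechet_derivative F (at (\<phi> (u *\<^sub>R axis 1 1))) (d\<phi> (u *\<^sub>R axis 1 1) (axis 1 1)) = u *\<^sub>R H u"
  unfolding dF_d\<phi>[OF assms] vector_3_axis H_def
  by (simp add: linear_add[OF linear_d\<Psi>[OF cusp_in_T[OF assms]]]
      linear_scale[OF linear_d\<Psi>[OF cusp_in_T[OF assms]]] algebra_simps power2_eq_square)

lemma dF_d\<phi>_axis_2:
  assumes "u *\<^sub>R axis 1 1 \<in> W"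
  shows "frechet_derivative F (at (\<phi> (u *\<^sub>R axis 1 1))) (d\<phi> (u *\<^sub>R axis 1 1) (axis 2 1))
    = frechet_derivative \<Psi> (at (cusp_map (u *\<^sub>R axis 1 1))) (axis 3 1)"
  unfolding dF_d\<phi>[OF assms] vector_3_axis by simp

lemma open_axis_W: "open {u::real. u *\<^sub>R axis 1 1 \<in> W}"
  using open_vimage[OF open_W, of "\<lambda>u. u *\<^sub>R axis 1 1"]
  by (simp add: vimage_def continuous_intros)

lemma b_normal: "b \<bullet> N (\<phi> 0) = 0"
  using normal[OF \<phi>0_in_D, of "d\<phi> 0 (axis 2 1)"] by (simp add: dF_d\<phi>_0)

text \<open>At the singular point itself the derivative in the first direction vanishes and says
  nothing about \<open>a\<close>. For \<open>u \<noteq> 0\<close> the factor \<open>u\<close> in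
  \<open>u *\<^sub>R H u\<close> can be cancelled from the orthogonality relation, and the limit
  \<open>H 0 = 2 *\<^sub>R a\<close> inherits it.\<close>

lemma a_normal: "a \<bullet> N (\<phi> 0) = 0"
proof -
  let ?k = "\<lambda>u. H u \<bullet> N (\<phi> (u *\<^sub>R axis 1 1))"
  have "?k \<midarrow>0\<rightarrow> ?k 0"
    using isCont_inner[OF isCont_H isCont_N_axis] by (simp add: isCont_def)
  moreover have "\<forall>\<^sub>F u in at 0. ?k u = 0"
    unfolding eventually_at_topological
  proof (intro exI[of _ "{u. u *\<^sub>R axis 1 1 \<in> W}"] conjI ballI impI)
    fix u :: real assume "u \<in> {u. u *\<^sub>R axis 1 1 \<in> W}" "u \<noteq> 0"
    then have u: "u *\<^sub>R axis 1 1 \<in> W" by simp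
    then have "\<phi> (u *\<^sub>R axis 1 1) \<in> D" using \<phi>_in_D by blast
    from normal[OF this, of "d\<phi> (u *\<^sub>R axis 1 1) (axis 1 1)"] \<open>u \<noteq> 0\<close>
    show "?k u = 0" by (simp add: dF_d\<phi>_axis_1[OF u])
  qed (use open_axis_W zero_in_W in auto)
  then have "?k \<midarrow>0\<rightarrow> 0" by (rule tendsto_eventually)
  ultimately have "?k 0 = 0" by (rule LIM_unique)
  then show ?thesis by (simp add: H_0)
qed

section \<open>The signed area density and its derivative in the null direction\<close>

definition lam where
  "lam x = det3 (frechet_derivative F (at x) (axis 1 1)) (frechet_derivative F (at x) (axis 2 1)) (N x)"

text \<open>The Jacobian determinant of \<open>\<phi>\<close>. Its sign is undetermined, because a
  diffeomorphism to the normal form may reverse orientation.\<close>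

definition J where "J w = det2 (d\<phi> w (axis 1 1)) (d\<phi> w (axis 2 1))"

lemma d\<phi>_eq_0: "w \<in> W \<Longrightarrow> d\<phi> w v = 0 \<Longrightarrow> v = 0"
  using d\<xi>_d\<phi>[of w v] d\<xi>_d\<phi>[of w 0] linear_0[OF linear_d\<phi>[of w]] by simp

lemma J_nonzero:
  assumes "w \<in> W"
  shows "J w \<noteq> 0"
proof
  assume J: "J w = 0"
  note lin = linear_d\<phi>[OF assms]
  have "d\<phi> w (axis 1 1) $ i = 0" for i
  proof -
    \<comment> \<open>In this combination of the two columns the \<open>i\<close>-th coordinate
      cancels identically and the other one equals \<open>J w\<close> up to sign.\<close>
    have "d\<phi> w (d\<phi> w (axis 2 1) $ i *\<^sub>R axis 1 1 - d\<phi> w (axis 1 1) $ i *\<^sub>R axis 2 1) = 0"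
      using J exhaust_2[of i]
      by (auto simp: linear_diff[OF lin] linear_scale[OF lin] vec_eq_iff forall_2 J_def det2_expand
          algebra_simps)
    from arg_cong[OF d\<phi>_eq_0[OF assms this], of "\<lambda>v. v $ 2"] show ?thesis
      by (simp add: axis_def)
  qed
  then have "axis 1 1 = (0::real^2)"
    using d\<phi>_eq_0[OF assms, of "axis 1 1"] by (simp add: vec_eq_iff)
  then show False by simp
qed

text \<open>The determinant is bilinear and alternating in the two tangent vectors, so changing
  their basis contributes the factor \<open>J w\<close>.\<close>

lemma lam_\<phi>:
  assumes "w \<in> W"
  shows "lam (\<phi> w) * J w = det3 (frechet_derivative F (at (\<phi> w)) (d\<phi> w (axis 1 1)))
    (frechet_derivative F (at (\<phi> w)) (d\<phi> w (axis 2 1))) (N (\<phi> w))"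
proof -
  have "\<phi> w \<in> D" using assms \<phi>_in_D by blast
  note lin = linear_dF[OF this]
  have "frechet_derivative F (at (\<phi> w)) v = v$1 *\<^sub>R frechet_derivative F (at (\<phi> w)) (axis 1 1)
      + v$2 *\<^sub>R frechet_derivative F (at (\<phi> w)) (axis 2 1)" for v
    by (subst vec2_axis[of v]) (simp add: linear_add[OF lin] linear_scale[OF lin])
  from this[of "d\<phi> w (axis 1 1)"] this[of "d\<phi> w (axis 2 1)"] show ?thesis
    by (simp add: det3_linear_combination lam_def J_def det2_expand)
qed

lemma lam_differentiable: "x \<in> D \<Longrightarrow> lam differentiable at x"
  unfolding lam_def[abs_def]
  by (intro differentiable_det3 smooth_on_differentiable[OF smooth_on_frechet_derivative[OF smooth_F]]
      smooth_on_differentiable[OF smooth_N])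

text \<open>Along the first axis the product of \<open>lam\<close> and \<open>J\<close> equals
  \<open>u * m u\<close> with \<open>m\<close> continuous. Comparing derivatives at 0 gives the
  claim, since \<open>lam\<close> vanishes at the singular point.\<close>

lemma dlam: "frechet_derivative lam (at (\<phi> 0)) (d\<phi> 0 (axis 1 1)) * J 0 = 2 * det3 a b (N (\<phi> 0))"
proof -
  let ?g = "\<lambda>u::real. u *\<^sub>R axis 1 1 :: real^2"
  have g: "(?g has_vector_derivative axis 1 1) (at 0)"
    by (auto intro!: derivative_eq_intros)
  have \<phi>g: "((\<lambda>u. \<phi> (?g u)) has_vector_derivative d\<phi> 0 (axis 1 1)) (at 0)"
    unfolding d\<phi>_def
    by (rule has_vector_derivative_compose_has_derivative[OF g])
       (use smooth_on_has_derivative[OF smooth_\<phi> zero_in_W] in simp)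
  have 1: "((\<lambda>u. lam (\<phi> (?g u))) has_vector_derivative
      frechet_derivative lam (at (\<phi> 0)) (d\<phi> 0 (axis 1 1))) (at 0)"
    by (rule has_vector_derivative_compose_has_derivative[OF \<phi>g])
       (use lam_differentiable[OF \<phi>0_in_D] in \<open>simp add: frechet_derivative_works\<close>)
  have "J differentiable at 0"
    unfolding J_def[abs_def] d\<phi>_def
    by (intro differentiable_det2 smooth_on_differentiable[OF smooth_on_frechet_derivative[OF smooth_\<phi>]]
        zero_in_W)
  then have 2: "((\<lambda>u. J (?g u)) has_vector_derivative frechet_derivative J (at 0) (axis 1 1)) (at 0)"
    by (intro has_vector_derivative_compose_has_derivative[OF g]) (simp add: frechet_derivative_works)
  \<comment> \<open>Both tangent vectors are mapped to multiples of \<open>b\<close> here.\<close>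
  have lam0: "lam (\<phi> 0) * J 0 = 0"
    using lam_\<phi>[OF zero_in_W] by (simp add: dF_d\<phi>_0 det3_expand)
  define m where "m u = det3 (H u) (frechet_derivative \<Psi> (at (cusp_map (?g u))) (axis 3 1))
    (N (\<phi> (?g u)))" for u
  have m: "lam (\<phi> (?g u)) * J (?g u) = u * m u" if "?g u \<in> W" for u
    using lam_\<phi>[OF that] by (simp add: dF_d\<phi>_axis_1[OF that] dF_d\<phi>_axis_2[OF that] det3_scaleR m_def)
  have "isCont m 0"
    unfolding m_def[abs_def] by (intro continuous_det3 isCont_H isCont_d\<Psi>_cusp isCont_N_axis)
  \<comment> \<open>By the Caratheodory characterization, continuity of \<open>m\<close> at 0
    suffices to differentiate \<open>u * m u\<close> there.\<close>
  then have "((\<lambda>u. u * m u) has_real_derivative m 0) (at 0)"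
    unfolding CARAT_DERIV by (intro exI[of _ m]) (simp add: mult.commute)
  then have "((\<lambda>u. lam (\<phi> (?g u)) * J (?g u)) has_real_derivative m 0) (at 0)"
    by (rule has_field_derivative_transform_within_open[OF _ open_axis_W])
       (use zero_in_W in \<open>simp_all add: m\<close>)
  moreover have "((\<lambda>u. lam (\<phi> (?g u)) * J (?g u)) has_real_derivative
      lam (\<phi> 0) * frechet_derivative J (at 0) (axis 1 1)
      + frechet_derivative lam (at (\<phi> 0)) (d\<phi> 0 (axis 1 1)) * J 0) (at 0)"
    using DERIV_mult'[OF 1[folded has_real_derivative_iff_has_vector_derivative]
        2[folded has_real_derivative_iff_has_vector_derivative]] by simp
  ultimately have "m 0 = lam (\<phi> 0) * frechet_derivative J (at 0) (axis 1 1)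
      + frechet_derivative lam (at (\<phi> 0)) (d\<phi> 0 (axis 1 1)) * J 0"
    by (rule DERIV_unique)
  moreover have "m 0 = 2 * det3 a b (N (\<phi> 0))"
    by (simp add: m_def H_0 det3_scaleR b_def)
  moreover have "lam (\<phi> 0) = 0"
    using lam0 J_nonzero[OF zero_in_W] by simp
  ultimately show ?thesis by simp
qed

section \<open>The image curve of the singular set\<close>

definition T\<^sub>3 where "T\<^sub>3 = {z::real. z *\<^sub>R axis 3 1 \<in> T}"

lemma open_T3: "open T\<^sub>3"
  using open_vimage[OF open_T, of "\<lambda>z. z *\<^sub>R axis 3 1"]
  by (simp add: T\<^sub>3_def vimage_def continuous_intros)

lemma zero_in_T3: "0 \<in> T\<^sub>3"
  by (simp add: T\<^sub>3_def zero_in_T)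

lemma smooth_\<psi>: "smooth_on T\<^sub>3 \<psi>"
  unfolding \<psi>_def[abs_def]
  by (rule smooth_on_compose[OF open_T3 open_T _ bounded_linear_imp_smooth_on smooth_\<Psi>])
     (auto simp: T\<^sub>3_def bounded_linear_scaleR_left)

lemma \<psi>_0: "\<psi> 0 = F (\<phi> 0)"
  using F_\<phi>[OF zero_in_W] by (simp add: \<psi>_def)

lemma \<psi>_derivative_0: "vector_derivative \<psi> (at 0) = b"
proof (rule vector_derivative_at)
  have z: "((\<lambda>z. z *\<^sub>R axis 3 1 :: real^3) has_vector_derivative axis 3 1) (at 0)"
    by (auto intro!: derivative_eq_intros)
  show "(\<psi> has_vector_derivative b) (at 0)"
    unfolding \<psi>_def[abs_def] b_def
    by (rule has_vector_derivative_compose_has_derivative[OF z])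
       (simp add: smooth_on_has_derivative[OF smooth_\<Psi> zero_in_T])
qed

lemma \<psi>_second_derivative_0: "((\<lambda>z. vector_derivative \<psi> (at z)) has_vector_derivative q) (at 0)"
  unfolding q_def
  by (rule has_vector_derivative_vector_derivative_smooth[OF
        smooth_on_vector_derivative[OF open_T3 smooth_\<psi>] zero_in_T3])

text \<open>Since \<open>n\<close> is orthogonal to the tangent \<open>b\<close>, the height
  \<open>n \<bullet> \<psi> z\<close> has a critical point at 0, as
  \<open>second_order_bound\<close> requires.\<close>

lemma singular_image_bound:
  assumes "n \<bullet> b = 0" "\<epsilon> > 0"
  shows "\<exists>\<rho>>0. \<forall>z. \<bar>z\<bar> < \<rho> \<longrightarrow> (\<exists>\<theta>. 0 \<le> \<theta> \<and> \<theta> \<le> 1 \<and>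
    \<bar>n \<bullet> (\<psi> z - \<psi> 0) - \<theta> * (n \<bullet> q) * z\<^sup>2\<bar> \<le> \<theta> * \<epsilon> * z\<^sup>2)"
proof -
  obtain r where "r > 0" and r: "\<And>z. \<bar>z\<bar> < r \<Longrightarrow> z \<in> T\<^sub>3"
    using open_T3 zero_in_T3 by (force simp: open_dist)
  show ?thesis
    unfolding inner_diff_right
  proof (rule second_order_bound[OF \<open>r > 0\<close> _ _ _ \<open>\<epsilon> > 0\<close>,
        where h' = "\<lambda>z. n \<bullet> vector_derivative \<psi> (at z)"])
    fix z :: real assume "\<bar>z\<bar> < r"
    then show "((\<lambda>z. n \<bullet> \<psi> z) has_real_derivative n \<bullet> vector_derivative \<psi> (at z)) (at z)"
      using bounded_linear.has_vector_derivative[OF bounded_linear_inner_right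
          has_vector_derivative_vector_derivative_smooth[OF smooth_\<psi> r]]
      by (simp add: has_real_derivative_iff_has_vector_derivative)
  next
    show "((\<lambda>z. n \<bullet> vector_derivative \<psi> (at z)) has_real_derivative n \<bullet> q) (at 0)"
      using bounded_linear.has_vector_derivative[OF bounded_linear_inner_right \<psi>_second_derivative_0]
      by (simp add: has_real_derivative_iff_has_vector_derivative)
  qed (simp add: \<psi>_derivative_0 assms)
qed

section \<open>The height of the front in a direction \<open>n\<close>\<close>

lemma neighborhood:
  assumes "\<rho> > 0"
  shows "open {x \<in> \<phi> ` W. norm (\<xi> x) < \<rho>}" "\<phi> 0 \<in> {x \<in> \<phi> ` W. norm (\<xi> x) < \<rho>}"
proof -
  have "open (\<phi> ` W \<inter> \<xi> -` ball 0 \<rho>)"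
    by (rule continuous_open_preimage[OF smooth_on_continuous_on[OF smooth_\<xi>] open_\<phi>_W open_ball])
  moreover have "\<phi> ` W \<inter> \<xi> -` ball 0 \<rho> = {x \<in> \<phi> ` W. norm (\<xi> x) < \<rho>}"
    by auto
  ultimately show "open {x \<in> \<phi> ` W. norm (\<xi> x) < \<rho>}" by simp
  show "\<phi> 0 \<in> {x \<in> \<phi> ` W. norm (\<xi> x) < \<rho>}" using assms zero_in_W by auto
qed

text \<open>The intermediate point lies on the singular image and has the same second coordinate as
  \<open>x\<close>.\<close>

lemma F_decomposition:
  assumes "x \<in> \<phi> ` W"
  shows "n \<bullet> (F x - F (\<phi> 0)) = n \<bullet> (\<Psi> (cusp_map (\<xi> x)) - \<Psi> (\<xi> x $ 2 *\<^sub>R axis 3 1))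
    + n \<bullet> (\<psi> (\<xi> x $ 2) - \<psi> 0)"
  using F_\<phi>[OF \<xi>_in_W[OF assms]] \<phi>_\<xi>[OF assms]
  by (simp add: \<psi>_0 inner_diff_right) (simp add: \<psi>_def)

lemma image_in_half_space:
  assumes "n \<bullet> a > 0" "n \<bullet> b = 0" "n \<bullet> q > 0"
  shows "\<exists>U. open U \<and> \<phi> 0 \<in> U \<and> U \<subseteq> D \<and> (\<forall>x\<in>U. n \<bullet> (F x - F (\<phi> 0)) \<ge> 0)"
proof -
  obtain \<rho>\<^sub>1 c where \<rho>1: "\<rho>\<^sub>1 > 0" "c > 0" "\<And>w. norm w < \<rho>\<^sub>1 \<Longrightarrow>
      c * (w$1)\<^sup>2 \<le> n \<bullet> (\<Psi> (cusp_map w) - \<Psi> (w$2 *\<^sub>R axis 3 1))"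
    using cusp_map_half_space[OF open_T zero_in_T smooth_\<Psi>] assms(1) unfolding a_def by blast
  \<comment> \<open>The choice \<open>\<epsilon> = n \<bullet> q\<close> makes the error at most the
    main term, so the height of the singular image is nonnegative.\<close>
  obtain \<rho>\<^sub>2 where "\<rho>\<^sub>2 > 0" and \<rho>2: "\<And>z. \<bar>z\<bar> < \<rho>\<^sub>2 \<Longrightarrow> \<exists>\<theta>. 0 \<le> \<theta> \<and> \<theta> \<le> 1 \<and>
      \<bar>n \<bullet> (\<psi> z - \<psi> 0) - \<theta> * (n \<bullet> q) * z\<^sup>2\<bar> \<le> \<theta> * (n \<bullet> q) * z\<^sup>2"
    using singular_image_bound[OF assms(2,3)] by blast
  have "n \<bullet> (F x - F (\<phi> 0)) \<ge> 0" if x: "x \<in> \<phi> ` W" "norm (\<xi> x) < min \<rho>\<^sub>1 \<rho>\<^sub>2" for x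
  proof -
    have "\<bar>\<xi> x $ 2\<bar> < \<rho>\<^sub>2" using x component_le_norm_cart[of "\<xi> x" 2] by linarith
    then have "n \<bullet> (\<psi> (\<xi> x $ 2) - \<psi> 0) \<ge> 0" using \<rho>2[of "\<xi> x $ 2"] by auto
    moreover have "c * (\<xi> x $ 1)\<^sup>2 \<ge> 0" using \<rho>1(2) by simp
    then have "n \<bullet> (\<Psi> (cusp_map (\<xi> x)) - \<Psi> (\<xi> x $ 2 *\<^sub>R axis 3 1)) \<ge> 0"
      using \<rho>1(3)[of "\<xi> x"] x by auto
    ultimately show ?thesis unfolding F_decomposition[OF x(1)] by simp
  qed
  then show ?thesis
    using neighborhood[of "min \<rho>\<^sub>1 \<rho>\<^sub>2"] \<rho>1(1) \<open>\<rho>\<^sub>2 > 0\<close> \<phi>_in_D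
    by (intro exI[of _ "{x \<in> \<phi> ` W. norm (\<xi> x) < min \<rho>\<^sub>1 \<rho>\<^sub>2}"]) auto
qed

lemma null_curve_in_half_space:
  assumes "n \<bullet> a < 0" "n \<bullet> b = 0"
    and x: "(x has_vector_derivative v) (at 0)" "x 0 = \<phi> 0"
    and v: "v \<noteq> 0" "frechet_derivative F (at (\<phi> 0)) v = 0"
  shows "\<forall>\<^sub>F s in nhds 0. n \<bullet> (F (x s) - F (\<phi> 0)) \<le> 0"
proof -
  \<comment> \<open>Applied to \<open>- n\<close>, the lower bound for the cusp term becomes an
    upper bound for its height in direction \<open>n\<close>.\<close>
  have "(- n) \<bullet> frechet_derivative \<Psi> (at 0) (axis 1 1) > 0" using assms(1) by (simp add: a_def)
  from cusp_map_half_space[OF open_T zero_in_T smooth_\<Psi> this]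
  obtain \<rho>\<^sub>1 c where \<rho>1: "\<rho>\<^sub>1 > 0" "c > 0" "\<And>w. norm w < \<rho>\<^sub>1 \<Longrightarrow>
      c * (w$1)\<^sup>2 \<le> (- n) \<bullet> (\<Psi> (cusp_map w) - \<Psi> (w$2 *\<^sub>R axis 3 1))"
    by blast
  \<comment> \<open>Any positive error serves here, as only a quadratic upper bound with some
    constant \<open>C\<close> is wanted.\<close>
  obtain \<rho>\<^sub>2 where "\<rho>\<^sub>2 > 0" and \<rho>2: "\<And>z. \<bar>z\<bar> < \<rho>\<^sub>2 \<Longrightarrow> \<exists>\<theta>. 0 \<le> \<theta> \<and> \<theta> \<le> 1 \<and>
      \<bar>n \<bullet> (\<psi> z - \<psi> 0) - \<theta> * (n \<bullet> q) * z\<^sup>2\<bar> \<le> \<theta> * 1 * z\<^sup>2"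
    using singular_image_bound[OF assms(2), of 1] by auto
  define C where "C = \<bar>n \<bullet> q\<bar> + 1"
  have C: "n \<bullet> (\<psi> z - \<psi> 0) \<le> C * z\<^sup>2" if z: "\<bar>z\<bar> < \<rho>\<^sub>2" for z
  proof -
    obtain \<theta> where \<theta>: "0 \<le> \<theta>" "\<theta> \<le> 1" "\<bar>n \<bullet> (\<psi> z - \<psi> 0) - \<theta> * (n \<bullet> q) * z\<^sup>2\<bar> \<le> \<theta> * 1 * z\<^sup>2"
      using \<rho>2[OF z] by blast
    have "n \<bullet> (\<psi> z - \<psi> 0) \<le> \<theta> * (n \<bullet> q + 1) * z\<^sup>2"
      using \<theta>(3) by (simp add: algebra_simps)
    also have "\<dots> \<le> \<theta> * C * z\<^sup>2"
      using \<theta> by (intro mult_right_mono mult_left_mono) (auto simp: C_def)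
    also have "\<dots> \<le> 1 * C * z\<^sup>2"
      using \<theta> by (intro mult_right_mono) (auto simp: C_def)
    finally show ?thesis by simp
  qed
  define \<beta> where "\<beta> = frechet_derivative \<xi> (at (\<phi> 0)) v $ 1"
  have \<beta>: "frechet_derivative \<xi> (at (\<phi> 0)) v = \<beta> *\<^sub>R axis 1 1" "v = \<beta> *\<^sub>R d\<phi> 0 (axis 1 1)"
    using null_direction[OF v(2)] unfolding \<beta>_def by blast+
  have "\<beta> \<noteq> 0" using \<beta>(2) v(1) by auto
  have "((\<lambda>s. \<xi> (x s)) has_vector_derivative \<beta> *\<^sub>R axis 1 1) (at 0)"
    unfolding \<beta>(1)[symmetric]
    by (rule has_vector_derivative_compose_has_derivative[OF x(1)])
       (use smooth_on_has_derivative[OF smooth_\<xi>, of "\<phi> 0"] zero_in_W in \<open>simp add: x(2)\<close>)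
  \<comment> \<open>Along the null curve the positive contribution of at most
    \<open>C * v\<^sup>2\<close> is absorbed by the negative one, which is at most
    \<open>- c * u\<^sup>2\<close>.\<close>
  then have tangent: "\<forall>\<^sub>F s in nhds 0. C * (\<xi> (x s) $ 2)\<^sup>2 \<le> c * (\<xi> (x s) $ 1)\<^sup>2"
    using curve_tangent_to_first_axis[of "\<lambda>s. \<xi> (x s)"] x(2) zero_in_W \<open>\<beta> \<noteq> 0\<close> \<rho>1(2) by simp
  define U where "U = {x \<in> \<phi> ` W. norm (\<xi> x) < min \<rho>\<^sub>1 \<rho>\<^sub>2}"
  have U: "open U" "x 0 \<in> U"
    using neighborhood[of "min \<rho>\<^sub>1 \<rho>\<^sub>2"] \<rho>1(1) \<open>\<rho>\<^sub>2 > 0\<close> by (simp_all add: U_def x(2))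
  have "(x \<longlongrightarrow> x 0) (nhds 0)"
    using has_vector_derivative_continuous[OF x(1)] by (simp add: isCont_def tendsto_at_iff_tendsto_nhds)
  from topological_tendstoD[OF this U] tangent show ?thesis
  proof eventually_elim
    case (elim s)
    then have s: "x s \<in> \<phi> ` W" "norm (\<xi> (x s)) < \<rho>\<^sub>1" "norm (\<xi> (x s)) < \<rho>\<^sub>2" by (auto simp: U_def)
    have "\<bar>\<xi> (x s) $ 2\<bar> < \<rho>\<^sub>2" using s component_le_norm_cart[of "\<xi> (x s)" 2] by linarith
    from C[OF this] \<rho>1(3)[OF s(2)] elim(2) show ?case
      unfolding F_decomposition[OF s(1)] by simp
  qed
qed

end

section \<open>The sign of the singular curvature\<close>

text \<open>Here \<open>x\<close> is the singular curve read in the chart and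
  \<open>\<alpha>\<close> its image in space. The two are linked only on \<open>S\<close>, the
  parameters for which the curve stays in the chart.\<close>

locale cuspidal_edge_singular_curve = cuspidal_edge_chart +
  fixes S :: "real set" and x :: "real \<Rightarrow> real^2" and \<alpha> :: "real \<Rightarrow> real^3"
  assumes open_S: "open S" and zero_in_S: "0 \<in> S" and smooth_x: "smooth_on S x"
    and x_0: "x 0 = \<phi> 0"
    and x_regular: "vector_derivative x (at 0) \<noteq> 0"
    and x_singular: "\<And>t. t \<in> S \<Longrightarrow> \<not> inj (frechet_derivative F (at (x t)))"
    and \<alpha>: "\<And>t. t \<in> S \<Longrightarrow> \<alpha> t = F (x t)"
begin

definition R where "R = {t \<in> S. x t \<in> \<phi> ` W}"
definition g where "g t = \<xi> (x t) $ 2"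
definition k where "k = vector_derivative g (at 0)"
definition y where "y = vector_derivative \<alpha> (at 0)"
definition y' where "y' = vector_derivative (\<lambda>t. vector_derivative \<alpha> (at t)) (at 0)"
definition n where "n = principal_normal \<alpha> 0"

lemma R: "open R" "0 \<in> R" "R \<subseteq> S"
proof -
  have "open (S \<inter> x -` \<phi> ` W)"
    by (rule continuous_open_preimage[OF smooth_on_continuous_on[OF smooth_x] open_S open_\<phi>_W])
  moreover have "S \<inter> x -` \<phi> ` W = R" by (auto simp: R_def)
  ultimately show "open R" by simp
  show "0 \<in> R" "R \<subseteq> S" using zero_in_S x_0 zero_in_W by (auto simp: R_def)
qed

text \<open>By \<open>inj_dF\<close> a singular point has first coordinate 0, so \<open>g\<close>
  reparametrizes the axis \<open>u = 0\<close> and \<open>\<alpha>\<close> becomes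
  \<open>\<psi>\<close> after \<open>g\<close>.\<close>

lemma \<xi>_x: "t \<in> R \<Longrightarrow> \<xi> (x t) = g t *\<^sub>R axis 2 1"
proof -
  assume "t \<in> R"
  then have t: "t \<in> S" "x t \<in> \<phi> ` W" by (auto simp: R_def)
  have "\<xi> (x t) $ 1 = 0"
    using inj_dF[OF \<xi>_in_W[OF t(2)]] x_singular[OF t(1)] \<phi>_\<xi>[OF t(2)] by auto
  then show ?thesis using vec2_axis[of "\<xi> (x t)"] by (simp add: g_def)
qed

lemma cusp_map_axis_2: "cusp_map (z *\<^sub>R axis 2 1) = z *\<^sub>R axis 3 1"
  by (simp add: cusp_map_def vector_3_axis)

lemma g_in_T3: "t \<in> R \<Longrightarrow> g t \<in> T\<^sub>3"
  using cusp_in_T[OF \<xi>_in_W, of "x t"] \<xi>_x[of t] by (simp add: T\<^sub>3_def R_def cusp_map_axis_2)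

lemma \<alpha>_eq: "t \<in> R \<Longrightarrow> \<alpha> t = \<psi> (g t)"
  using \<alpha>[of t] R(3) F_\<phi>[OF \<xi>_in_W, of "x t"] \<xi>_x[of t] \<phi>_\<xi>[of "x t"]
  by (auto simp: R_def \<psi>_def cusp_map_axis_2)

lemma g_0: "g 0 = 0"
  by (simp add: g_def x_0 zero_in_W)

lemma smooth_\<xi>_x: "smooth_on R (\<lambda>t. \<xi> (x t))"
  by (rule smooth_on_compose[OF R(1) open_\<phi>_W _ smooth_on_subset[OF smooth_x R(3)] smooth_\<xi>])
     (auto simp: R_def)

lemma smooth_g: "smooth_on R g"
  unfolding g_def[abs_def]
  by (rule smooth_on_bounded_linear[OF bounded_linear_vec_nth R(1) smooth_\<xi>_x])

lemma x_derivative: "vector_derivative x (at 0) = k *\<^sub>R d\<phi> 0 (axis 2 1)"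
proof -
  have x: "(x has_vector_derivative vector_derivative x (at 0)) (at 0)"
    by (rule has_vector_derivative_vector_derivative_smooth[OF smooth_x zero_in_S])
  have "((\<lambda>t. \<xi> (x t)) has_vector_derivative
      frechet_derivative \<xi> (at (\<phi> 0)) (vector_derivative x (at 0))) (at 0)"
    by (rule has_vector_derivative_compose_has_derivative[OF x])
       (use smooth_on_has_derivative[OF smooth_\<xi>, of "\<phi> 0"] zero_in_W in \<open>simp add: x_0\<close>)
  moreover have "((\<lambda>t. \<xi> (x t)) has_vector_derivative k *\<^sub>R axis 2 1) (at 0)"
  proof (rule has_vector_derivative_transform_within_open[OF _ R(1,2)])
    show "((\<lambda>t. g t *\<^sub>R axis 2 1 :: real^2) has_vector_derivative k *\<^sub>R axis 2 1) (at 0)"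
      unfolding k_def
      by (rule bounded_linear.has_vector_derivative[OF bounded_linear_scaleR_left
            has_vector_derivative_vector_derivative_smooth[OF smooth_g R(2)]])
  qed (simp add: \<xi>_x)
  ultimately have "frechet_derivative \<xi> (at (\<phi> 0)) (vector_derivative x (at 0)) = k *\<^sub>R axis 2 1"
    by (rule vector_derivative_unique_at)
  then show ?thesis
    using d\<phi>_d\<xi>[OF zero_in_W, of "vector_derivative x (at 0)"]
    by (simp add: linear_scale[OF linear_d\<phi>[OF zero_in_W]])
qed

lemma k_nonzero: "k \<noteq> 0"
  using x_derivative x_regular by auto

lemma \<alpha>_derivative:
  assumes "t \<in> R"
  shows "(\<alpha> has_vector_derivative vector_derivative g (at t) *\<^sub>R vector_derivative \<psi> (at (g t))) (at t)"
proof (rule has_vector_derivative_transform_within_open[OF _ R(1) assms])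
  show "((\<lambda>t. \<psi> (g t)) has_vector_derivative vector_derivative g (at t) *\<^sub>R vector_derivative \<psi> (at (g t))) (at t)"
    using vector_diff_chain_at[OF has_vector_derivative_vector_derivative_smooth[OF smooth_g assms]
        has_vector_derivative_vector_derivative_smooth[OF smooth_\<psi> g_in_T3[OF assms]]]
    by (simp add: o_def)
qed (simp add: \<alpha>_eq)

lemma y_eq: "y = k *\<^sub>R b"
  using vector_derivative_at[OF \<alpha>_derivative[OF R(2)]] by (simp add: y_def g_0 \<psi>_derivative_0 k_def)

lemma y_nonzero: "y \<noteq> 0"
  by (simp add: y_eq k_nonzero b_nonzero)

text \<open>Product and chain rule for \<open>\<psi>\<close> after \<open>g\<close>. The coefficient
  of \<open>b\<close> stays unspecified because later only the part orthogonal to \<open>b\<close>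
  matters.\<close>

lemma y'_eq:
  shows "((\<lambda>t. vector_derivative \<alpha> (at t)) has_vector_derivative y') (at 0)"
    and "\<exists>k'. y' = k' *\<^sub>R b + k\<^sup>2 *\<^sub>R q"
proof -
  let ?g' = "\<lambda>t. vector_derivative g (at t)" and ?\<psi>' = "\<lambda>t. vector_derivative \<psi> (at t)"
  obtain k' where k': "(?g' has_vector_derivative k') (at 0)"
    using has_vector_derivative_vector_derivative_smooth[OF smooth_on_vector_derivative[OF R(1) smooth_g] R(2)]
    by blast
  have "((\<lambda>t. ?\<psi>' (g t)) has_vector_derivative k *\<^sub>R q) (at 0)"
    using vector_diff_chain_at[OF has_vector_derivative_vector_derivative_smooth[OF smooth_g R(2)], of ?\<psi>' q]
      \<psi>_second_derivative_0 by (simp add: o_def g_0 k_def)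
  from has_vector_derivative_scaleR[OF k'[folded has_real_derivative_iff_has_vector_derivative] this]
  have "((\<lambda>t. ?g' t *\<^sub>R ?\<psi>' (g t)) has_vector_derivative k' *\<^sub>R b + k\<^sup>2 *\<^sub>R q) (at 0)"
    by (simp add: g_0 \<psi>_derivative_0 k_def power2_eq_square add.commute)
  then have D: "((\<lambda>t. vector_derivative \<alpha> (at t)) has_vector_derivative k' *\<^sub>R b + k\<^sup>2 *\<^sub>R q) (at 0)"
    by (rule has_vector_derivative_transform_within_open[OF _ R(1,2)])
       (simp add: vector_derivative_at[OF \<alpha>_derivative])
  show "((\<lambda>t. vector_derivative \<alpha> (at t)) has_vector_derivative y') (at 0)"
    "\<exists>k'. y' = k' *\<^sub>R b + k\<^sup>2 *\<^sub>R q"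
    using D vector_derivative_at[OF D] by (auto simp: y'_def)
qed

text \<open>The part of the acceleration orthogonal to the velocity: the curvature vector of the
  image curve times the square of its speed.\<close>

definition P where "P = y' - ((y \<bullet> y') / (y \<bullet> y)) *\<^sub>R y"

text \<open>The unit tangent has derivative \<open>P\<close> divided by the speed. If
  \<open>P = 0\<close>, both sides are the default value 0.\<close>

lemma n_eq: "n = sgn P"
proof -
  have "((\<lambda>s. sgn (vector_derivative \<alpha> (at s))) has_vector_derivative (1 / norm y) *\<^sub>R P) (at 0)"
    using has_vector_derivative_sgn[OF y'_eq(1)] y_nonzero by (simp add: y_def P_def)
  then have "vector_derivative (unit_tangent \<alpha>) (at 0) = (1 / norm y) *\<^sub>R P"
    unfolding unit_tangent_def[abs_def] by (rule vector_derivative_at)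
  then show ?thesis
    using y_nonzero by (simp add: n_def principal_normal_def sgn_scaleR)
qed

lemma P_y: "P \<bullet> y = 0"
  using y_nonzero by (simp add: P_def inner_diff_left inner_commute[of y' y])

lemma n_b: "n \<bullet> b = 0"
  using P_y by (simp add: n_eq sgn_div_norm y_eq k_nonzero)

text \<open>As \<open>P\<close> is orthogonal to the tangent,
  \<open>P \<bullet> P = P \<bullet> y' = k\<^sup>2 * (P \<bullet> q)\<close>.\<close>

lemma n_q:
  assumes "n \<noteq> 0"
  shows "n \<bullet> q > 0"
proof -
  have "P \<bullet> P > 0" using assms by (simp add: n_eq sgn_zero_iff)
  also have "P \<bullet> P = P \<bullet> y'"
    using P_y by (subst (2) P_def) (simp add: inner_diff_right)
  also have "\<dots> = k\<^sup>2 * (P \<bullet> q)"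
    using y'_eq(2) P_y k_nonzero by (auto simp: inner_add_right y_eq)
  finally have "P \<bullet> q > 0" by (simp add: zero_less_mult_iff)
  moreover have "norm P > 0" using \<open>P \<bullet> P > 0\<close> by auto
  ultimately show ?thesis by (simp add: n_eq sgn_div_norm)
qed

text \<open>Replacing \<open>d\<lambda> \<eta>\<close> by \<open>det3 y a N\<close>, which has the same sign, turns the singular curvature
  into a product of two determinants that is a Gram determinant.\<close>

lemma sgn_singular_curvature:
  assumes "\<eta> \<noteq> 0" "frechet_derivative F (at (\<phi> 0)) \<eta> = 0" "det2 (vector_derivative x (at 0)) \<eta> > 0"
  shows "sgn (sgn (frechet_derivative lam (at (\<phi> 0)) \<eta>) * det3 y y' (N (\<phi> 0)) / norm y ^ 3) = sgn (n \<bullet> a)"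
proof -
  define \<beta> where "\<beta> = frechet_derivative \<xi> (at (\<phi> 0)) \<eta> $ 1"
  have \<eta>: "\<eta> = \<beta> *\<^sub>R d\<phi> 0 (axis 1 1)"
    using null_direction(2)[OF assms(2)] unfolding \<beta>_def .
  define d where "d = det3 a b (N (\<phi> 0))"
  have lin: "linear (frechet_derivative lam (at (\<phi> 0)))"
    using lam_differentiable[OF \<phi>0_in_D] frechet_derivative_works has_derivative_linear by blast
  \<comment> \<open>The curve runs along the second axis and \<open>\<eta>\<close> along the first;
    this order reversal produces the minus sign.\<close>
  have "det2 (vector_derivative x (at 0)) \<eta> = - k * (\<beta> * J 0)"
    by (simp add: x_derivative \<eta> J_def det2_expand algebra_simps)
  then have "- k * (\<beta> * J 0) > 0" using assms(3) by simp
  then have sgn_k: "sgn (- k) = sgn (\<beta> * J 0)"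
    by (auto simp: zero_less_mult_iff mult_less_0_iff sgn_if split: if_splits)
  \<comment> \<open>The square of \<open>J 0\<close> does not affect the sign on the left, while
    \<open>\<beta> * J 0\<close> on the right has the sign of \<open>- k\<close> by the orientation
    of \<open>\<eta>\<close>.\<close>
  have "frechet_derivative lam (at (\<phi> 0)) \<eta> * (J 0)\<^sup>2 = 2 * d * (\<beta> * J 0)"
    using dlam by (simp add: \<eta> linear_scale[OF lin] power2_eq_square d_def)
  then have "sgn (frechet_derivative lam (at (\<phi> 0)) \<eta>) * sgn ((J 0)\<^sup>2) = sgn d * sgn (- k)"
    unfolding sgn_k sgn_mult[symmetric] by (simp add: sgn_mult)
  moreover have "sgn ((J 0)\<^sup>2) = 1"
    using J_nonzero[OF zero_in_W] by (intro sgn_pos) simp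
  moreover have "det3 y a (N (\<phi> 0)) = - k * d"
    by (simp add: y_eq det3_scaleR det3_swap[of b] d_def)
  ultimately have 1: "sgn (frechet_derivative lam (at (\<phi> 0)) \<eta>) = sgn (det3 y a (N (\<phi> 0)))"
    by (simp add: sgn_mult)
  \<comment> \<open>Both \<open>a\<close> and \<open>y\<close> are orthogonal to the unit normal, so
    the Gram identity applies and yields the orthogonal part \<open>P\<close> of
    \<open>y'\<close>.\<close>
  have 2: "det3 y a (N (\<phi> 0)) * det3 y y' (N (\<phi> 0)) = (y \<bullet> y) * (P \<bullet> a)"
  proof -
    have "(y \<bullet> y) * (P \<bullet> a) = (y \<bullet> y) * (a \<bullet> y') - (y \<bullet> y') * (a \<bullet> y)"
      using y_nonzero by (simp add: P_def inner_diff_left inner_commute[of a] field_simps)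
    moreover have "y \<bullet> N (\<phi> 0) = 0" by (simp add: y_eq b_normal)
    ultimately show ?thesis
      using det3_mult_det3_unit_normal[OF norm_N[OF \<phi>0_in_D] a_normal] by simp
  qed
  have "sgn (sgn (frechet_derivative lam (at (\<phi> 0)) \<eta>) * det3 y y' (N (\<phi> 0)) / norm y ^ 3)
      = sgn (det3 y a (N (\<phi> 0)) * det3 y y' (N (\<phi> 0)))"
    using y_nonzero by (simp add: 1 sgn_mult sgn_divide)
  also have "\<dots> = sgn (P \<bullet> a)"
    using y_nonzero by (simp add: 2 sgn_mult)
  \<comment> \<open>Normalizing \<open>P\<close> preserves the sign; for \<open>P = 0\<close> both
    signs are 0.\<close>
  also have "\<dots> = sgn (n \<bullet> a)"
  proof (cases "P = 0")
    case False
    have "n \<bullet> a = (P \<bullet> a) / norm P" by (simp add: n_eq sgn_div_norm divide_inverse_commute)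
    with False show ?thesis by (simp add: sgn_divide)
  qed (simp add: n_eq)
  finally show ?thesis .
qed

lemma positively_oriented_null_vector:
  "\<exists>\<eta>. \<eta> \<noteq> 0 \<and> frechet_derivative F (at (\<phi> 0)) \<eta> = 0 \<and> det2 (vector_derivative x (at 0)) \<eta> > 0"
proof -
  \<comment> \<open>The factor \<open>- k * J 0\<close> turns the determinant with the velocity into
    the square \<open>(k * J 0)\<^sup>2\<close>.\<close>
  define \<eta> where "\<eta> = (- k * J 0) *\<^sub>R d\<phi> 0 (axis 1 1)"
  have "frechet_derivative F (at (\<phi> 0)) \<eta> = 0"
    by (simp add: \<eta>_def linear_scale[OF linear_dF[OF \<phi>0_in_D]] linear_neg[OF linear_dF[OF \<phi>0_in_D]] dF_d\<phi>_0)
  moreover have "det2 (vector_derivative x (at 0)) \<eta> = (k * J 0)\<^sup>2"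
    by (simp add: x_derivative \<eta>_def J_def det2_expand algebra_simps power2_eq_square)
  moreover have "k * J 0 \<noteq> 0" using k_nonzero J_nonzero[OF zero_in_W] by simp
  ultimately show ?thesis by (intro exI[of _ \<eta>]) (auto simp: det2_expand)
qed

end

section \<open>Charts\<close>

lemma chart_on_inj:
  assumes "chart_on X c"
  shows "inj_on (snd c) (fst c)"
  using assms homeomorphic_imp_injective_map openin_subset
  by (fastforce simp: chart_on_def Int_absorb1)

lemma in_coords_chart: "chart_on X c \<Longrightarrow> q \<in> fst c \<Longrightarrow> in_coords c f (snd c q) = f q"
  by (simp add: in_coords_def chart_on_inj)

lemma chart_on_open_image:
  assumes "chart_on X c" "openin X U" "U \<subseteq> fst c"
  shows "open (snd c ` U)"
proof -
  have "openin (subtopology X (fst c)) U"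
    using assms by (simp add: openin_open_subtopology chart_on_def)
  then have "openin (top_of_set (snd c ` fst c)) (snd c ` U)"
    using assms(1) homeomorphic_imp_open_map unfolding chart_on_def open_map_def by blast
  then show ?thesis
    using assms(1) unfolding chart_on_def by (metis openin_open_trans)
qed

lemma chart_on_open_preimage:
  assumes "chart_on X c" "open V"
  shows "openin X {q \<in> fst c. snd c q \<in> V}"
proof -
  have "continuous_map (subtopology X (fst c)) euclidean (snd c)"
    using assms(1) homeomorphic_imp_continuous_map continuous_map_in_subtopology
    unfolding chart_on_def by blast
  then have "openin (subtopology X (fst c)) {q \<in> topspace (subtopology X (fst c)). snd c q \<in> V}"
    using assms(2) by (intro openin_continuous_map_preimage) auto
  moreover have "{q \<in> topspace (subtopology X (fst c)). snd c q \<in> V} = {q \<in> fst c. snd c q \<in> V}"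
    using assms(1) openin_subset[of X "fst c"] by (auto simp: chart_on_def)
  ultimately have "openin (subtopology X (fst c)) {q \<in> fst c. snd c q \<in> V}"
    by (simp only:)
  then show ?thesis
    using assms(1) openin_open_subtopology[of X "fst c"] by (simp add: chart_on_def)
qed

section \<open>Change of chart\<close>

lemma oriented_surface_chart: "oriented_surface X A \<Longrightarrow> c \<in> A \<Longrightarrow> chart_on X c"
  by (simp add: oriented_surface_def)

lemma transition_smooth:
  "oriented_surface X A \<Longrightarrow> c \<in> A \<Longrightarrow> d \<in> A
    \<Longrightarrow> smooth_on (snd c ` (fst c \<inter> fst d)) (in_coords c (snd d))"
  by (simp add: oriented_surface_def)

text \<open>The inverse is the transition map in the opposite direction, whose smoothness is again
  part of the atlas condition.\<close>

lemma transition_diffeomorphism: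
  assumes X: "oriented_surface X A" and c: "c \<in> A" and d: "d \<in> A"
  shows "diffeomorphism_on (snd c ` (fst c \<inter> fst d)) (in_coords c (snd d))"
proof -
  note cc = oriented_surface_chart[OF X c] and dd = oriented_surface_chart[OF X d]
  let ?U = "fst c \<inter> fst d"
  have U: "openin X ?U" using cc dd by (simp add: chart_on_def openin_Int)
  have opn: "open (snd c ` ?U)" "open (snd d ` ?U)"
    using chart_on_open_image[OF cc U] chart_on_open_image[OF dd U] by auto
  have im: "in_coords c (snd d) ` snd c ` ?U = snd d ` ?U"
    unfolding image_image by (rule image_cong) (simp_all add: in_coords_chart[OF cc])
  have inj: "inj_on (in_coords c (snd d)) (snd c ` ?U)"
    using chart_on_inj[OF dd] by (auto simp: inj_on_def in_coords_chart[OF cc])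
  have "smooth_on (snd d ` ?U) (inv_into (snd c ` ?U) (in_coords c (snd d)))"
  proof (rule smooth_on_cong[OF opn(2)])
    show "smooth_on (snd d ` ?U) (in_coords d (snd c))"
      using transition_smooth[OF X d c] by (simp add: Int_commute)
    fix y assume "y \<in> snd d ` ?U"
    then obtain r where r: "r \<in> ?U" "y = snd d r" by blast
    then have "y = in_coords c (snd d) (snd c r)" by (simp add: in_coords_chart[OF cc])
    then have "inv_into (snd c ` ?U) (in_coords c (snd d)) y = snd c r"
      using inv_into_f_f[OF inj, of "snd c r"] r(1) by blast
    then show "in_coords d (snd c) y = inv_into (snd c ` ?U) (in_coords c (snd d)) y"
      using r by (simp add: in_coords_chart[OF dd])
  qed
  moreover have "smooth_on (snd c ` ?U) (in_coords c (snd d))"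
    using transition_smooth[OF X c d] .
  ultimately show ?thesis
    using opn inj im by (simp add: diffeomorphism_on_def)
qed

lemma in_coords_transition:
  assumes "oriented_surface X A" "c \<in> A" "d \<in> A" "z \<in> snd c ` (fst c \<inter> fst d)"
  shows "in_coords d f (in_coords c (snd d) z) = in_coords c f z"
  using assms by (auto simp: in_coords_chart[OF oriented_surface_chart])

text \<open>Failure of \<open>immersion_at\<close> yields only some chart \<open>d\<close> with a
  non-injective derivative. An injective derivative in \<open>c\<close>, composed with the injective
  derivative of the transition map, would be injective in \<open>d\<close>.\<close>

lemma not_immersion_at_chart:
  fixes f :: "'a \<Rightarrow> 'b::real_normed_vector"
  assumes X: "oriented_surface X A" and f: "smooth_map A f" and "\<not> immersion_at A f p"
    and c: "c \<in> A" "p \<in> fst c"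
  shows "\<not> inj (diff_at c f p)"
proof
  assume inj_c: "inj (diff_at c f p)"
  obtain d where d: "d \<in> A" "p \<in> fst d" "\<not> inj (diff_at d f p)"
    using assms(3) by (auto simp: immersion_at_def)
  let ?S = "snd d ` (fst d \<inter> fst c)" and ?\<tau> = "in_coords d (snd c)"
  have p: "snd d p \<in> ?S" using c d by blast
  have \<tau>: "diffeomorphism_on ?S ?\<tau>" using transition_diffeomorphism[OF X d(1) c(1)] .
  have \<tau>_p: "?\<tau> (snd d p) = snd c p"
    using in_coords_chart[OF oriented_surface_chart[OF X d(1)] d(2)] .
  have "(?\<tau> has_derivative frechet_derivative ?\<tau> (at (snd d p))) (at (snd d p))"
    using \<tau> p smooth_on_has_derivative unfolding diffeomorphism_on_def by blast
  moreover have "(in_coords c f has_derivative diff_at c f p) (at (?\<tau> (snd d p)))"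
    unfolding \<tau>_p diff_at_def
    by (rule smooth_on_has_derivative[of "snd c ` fst c"]) (use f c in \<open>auto simp: smooth_map_def\<close>)
  ultimately have "((\<lambda>z. in_coords c f (?\<tau> z)) has_derivative
      (\<lambda>v. diff_at c f p (frechet_derivative ?\<tau> (at (snd d p)) v))) (at (snd d p))"
    by (rule has_derivative_compose)
  then have "(in_coords d f has_derivative
      (\<lambda>v. diff_at c f p (frechet_derivative ?\<tau> (at (snd d p)) v))) (at (snd d p))"
    by (rule has_derivative_transform_within_open[OF _ _ p])
       (use \<tau> in_coords_transition[OF X d(1) c(1)] in \<open>auto simp: diffeomorphism_on_def\<close>)
  then have "diff_at d f p = (\<lambda>v. diff_at c f p (frechet_derivative ?\<tau> (at (snd d p)) v))"
    unfolding diff_at_def[of d] by (rule frechet_derivative_at[symmetric])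
  moreover have "inj (frechet_derivative ?\<tau> (at (snd d p)))"
    using diffeomorphism_on_derivative_inverse[OF \<tau> p] by (rule inj_on_inverseI)
  ultimately have "inj (diff_at d f p)"
    using inj_compose[OF inj_c] by (simp add: o_def)
  with d(3) show False by simp
qed

text \<open>The definition provides the normal form in some chart \<open>c\<close> only, but the
  singular curvature may be evaluated in any chart around \<open>p\<close>. Composing
  \<open>\<phi>\<close> with the transition map moves the normal form to \<open>d\<close>.\<close>

lemma cuspidal_edge_in_chart:
  assumes X: "oriented_surface X A" and f: "front X A f \<nu>" and p: "cuspidal_edge X A f p"
    and d: "d \<in> A" "p \<in> fst d"
  shows "\<exists>W \<phi> V \<Phi>. cuspidal_edge_chart (in_coords d f) (in_coords d \<nu>) (snd d ` fst d) W \<phi> V \<Phi>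
    \<and> \<phi> 0 = snd d p"
proof -
  obtain c W \<phi> V and \<Phi> :: "real^3 \<Rightarrow> real^3" where c: "c \<in> A" "p \<in> fst c"
    and \<phi>: "diffeomorphism_on W \<phi>" "0 \<in> W" "\<phi> 0 = snd c p" "\<phi> ` W \<subseteq> snd c ` fst c"
    and \<Phi>: "diffeomorphism_on V \<Phi>" "in_coords c f ` \<phi> ` W \<subseteq> V"
      "\<forall>w\<in>W. \<Phi> (in_coords c f (\<phi> w)) = cusp_map w"
    using p unfolding cuspidal_edge_def cusp_map_def[symmetric]
    by - (elim conjE bexE exE, rule that, assumption+)
  note cc = oriented_surface_chart[OF X c(1)] and dd = oriented_surface_chart[OF X d(1)]
  let ?S = "snd c ` (fst c \<inter> fst d)" and ?\<tau> = "in_coords c (snd d)"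
  have \<tau>: "diffeomorphism_on ?S ?\<tau>" using transition_diffeomorphism[OF X c(1) d(1)] .
  have \<tau>_f: "in_coords d f (?\<tau> z) = in_coords c f z" if "z \<in> ?S" for z
    using in_coords_transition[OF X c(1) d(1) that] .
  \<comment> \<open>The transition map is defined only over the overlap of the charts, so the source
    of the normal form is shrunk.\<close>
  define W' where "W' = W \<inter> \<phi> -` ?S"
  have "open W'"
    unfolding W'_def
    by (rule continuous_open_preimage[OF smooth_on_continuous_on])
       (use \<phi>(1) \<tau> in \<open>simp_all add: diffeomorphism_on_def\<close>)
  then have \<phi>': "diffeomorphism_on W' \<phi>"
    by (rule diffeomorphism_on_subset[OF \<phi>(1)]) (simp add: W'_def)
  have in_S: "\<phi> w \<in> ?S" "w \<in> W" if "w \<in> W'" for w using that by (auto simp: W'_def)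
  have \<tau>_S: "?\<tau> z \<in> snd d ` fst d" if "z \<in> ?S" for z
    using that by (auto simp: in_coords_chart[OF cc])
  have "cuspidal_edge_chart (in_coords d f) (in_coords d \<nu>) (snd d ` fst d) W' (\<lambda>w. ?\<tau> (\<phi> w)) V \<Phi>"
  proof
    show "smooth_on (snd d ` fst d) (in_coords d f)" "smooth_on (snd d ` fst d) (in_coords d \<nu>)"
      using f d by (auto simp: front_def smooth_map_def)
    have "fst d \<subseteq> topspace X" using X d unfolding oriented_surface_def by blast
    then show "norm (in_coords d \<nu> z) = 1" if "z \<in> snd d ` fst d" for z
      using f that by (auto simp: front_def in_coords_chart[OF dd])
    show "frechet_derivative (in_coords d f) (at z) v \<bullet> in_coords d \<nu> z = 0"
      if "z \<in> snd d ` fst d" for z v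
      using f d that by (auto simp: front_def diff_at_def in_coords_chart[OF dd])
    show "diffeomorphism_on W' (\<lambda>w. ?\<tau> (\<phi> w))"
      by (rule diffeomorphism_on_compose[OF \<phi>' \<tau>]) (auto simp: W'_def)
    show "0 \<in> W'" using \<phi>(2,3) c d by (simp add: W'_def)
    show "(\<lambda>w. ?\<tau> (\<phi> w)) ` W' \<subseteq> snd d ` fst d" using \<tau>_S in_S(1) by blast
    show "diffeomorphism_on V \<Phi>" using \<Phi>(1) .
    show "in_coords d f ` (\<lambda>w. ?\<tau> (\<phi> w)) ` W' \<subseteq> V" using \<Phi>(2) in_S \<tau>_f by auto
    show "\<Phi> (in_coords d f (?\<tau> (\<phi> w))) = cusp_map w" if "w \<in> W'" for w
      using \<Phi>(3) in_S[OF that] \<tau>_f by simp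
  qed
  moreover have "?\<tau> (\<phi> 0) = snd d p" by (simp add: \<phi>(3) in_coords_chart[OF cc c(2)])
  ultimately show ?thesis
    by (intro exI[of _ W'] exI[of _ "\<lambda>w. ?\<tau> (\<phi> w)"] exI[of _ V] exI[of _ \<Phi>]) auto
qed

section \<open>Curves on the surface, read in a chart\<close>

lemma regular_curve_open_preimage:
  assumes "regular_curve X A I \<gamma>" "openin X U"
  shows "open {t \<in> I. \<gamma> t \<in> U}"
proof -
  have "openin (top_of_set I) {t \<in> topspace (top_of_set I). \<gamma> t \<in> U}"
    using assms by (intro openin_continuous_map_preimage) (auto simp: regular_curve_def)
  then show ?thesis
    using assms(1) openin_open_trans by (fastforce simp: regular_curve_def)
qed

lemma regular_curve_near:
  assumes "regular_curve X A I \<gamma>" "openin X U" "0 \<in> I" "\<gamma> 0 \<in> U"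
  shows "\<exists>\<delta>>0. \<forall>t. \<bar>t\<bar> < \<delta> \<longrightarrow> t \<in> I \<and> \<gamma> t \<in> U"
  using regular_curve_open_preimage[OF assms(1,2)] assms(3,4) by (force simp: open_dist)

lemma singular_curve_in_chart:
  assumes X: "oriented_surface X A" and f: "front X A f \<nu>" and p: "cuspidal_edge X A f p"
    and \<gamma>: "singular_curve X A f p I \<gamma>" and d: "d \<in> A" "p \<in> fst d"
  shows "\<exists>W \<phi> V \<Phi>. cuspidal_edge_singular_curve (in_coords d f) (in_coords d \<nu>) (snd d ` fst d)
      W \<phi> V \<Phi> {t \<in> I. \<gamma> t \<in> fst d} (\<lambda>t. snd d (\<gamma> t)) (f \<circ> \<gamma>) \<and> \<phi> 0 = snd d p"
proof -
  obtain W \<phi> V \<Phi> where chart: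
      "cuspidal_edge_chart (in_coords d f) (in_coords d \<nu>) (snd d ` fst d) W \<phi> V \<Phi>"
    and \<phi>0: "\<phi> 0 = snd d p"
    using cuspidal_edge_in_chart[OF X f p d] by blast
  note dd = oriented_surface_chart[OF X d(1)]
  have reg: "regular_curve X A I \<gamma>" and 0: "0 \<in> I" "\<gamma> 0 = p"
    and sing: "\<And>t. t \<in> I \<Longrightarrow> \<not> immersion_at A f (\<gamma> t)"
    using \<gamma> by (auto simp: singular_curve_def singular_points_def)
  interpret cuspidal_edge_chart "in_coords d f" "in_coords d \<nu>" "snd d ` fst d" W \<phi> V \<Phi>
    by (rule chart)
  have "cuspidal_edge_singular_curve (in_coords d f) (in_coords d \<nu>) (snd d ` fst d)
      W \<phi> V \<Phi> {t \<in> I. \<gamma> t \<in> fst d} (\<lambda>t. snd d (\<gamma> t)) (f \<circ> \<gamma>)"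
  proof
    show "open {t \<in> I. \<gamma> t \<in> fst d}"
      by (rule regular_curve_open_preimage[OF reg]) (use dd in \<open>simp add: chart_on_def\<close>)
    show "0 \<in> {t \<in> I. \<gamma> t \<in> fst d}" using 0 d by simp
    show "smooth_on {t \<in> I. \<gamma> t \<in> fst d} (\<lambda>t. snd d (\<gamma> t))"
      using reg d by (simp add: regular_curve_def)
    show "snd d (\<gamma> 0) = \<phi> 0" by (simp add: 0 \<phi>0)
    show "vector_derivative (\<lambda>t. snd d (\<gamma> t)) (at 0) \<noteq> 0"
      using reg d 0 by (auto simp: regular_curve_def velocity_def)
    show "\<not> inj (frechet_derivative (in_coords d f) (at (snd d (\<gamma> t))))" if "t \<in> {t \<in> I. \<gamma> t \<in> fst d}" for t
      using not_immersion_at_chart[OF X _ sing d(1), of t] f that by (simp add: front_def diff_at_def)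
    show "(f \<circ> \<gamma>) t = in_coords d f (snd d (\<gamma> t))" if "t \<in> {t \<in> I. \<gamma> t \<in> fst d}" for t
      using that by (simp add: in_coords_chart[OF dd])
  qed
  then show ?thesis using \<phi>0 by blast
qed

section \<open>The half-space statements on the surface\<close>

theorem corollary1p18:
  fixes X :: "'a topology" and A :: "'a chart set"
    and f \<nu> :: "'a \<Rightarrow> real^3" and p :: 'a and I :: "real set" and \<gamma> :: "real \<Rightarrow> 'a"
  assumes "oriented_surface X A"
    and "front X A f \<nu>"
    and "cuspidal_edge X A f p"
    and "singular_curve X A f p I \<gamma>"
  shows "(singular_curvature A f \<nu> \<gamma> 0 > 0 \<longrightarrow>
            (\<forall>J \<sigma>. null_curve X A f J \<sigma> \<and> 0 \<in> J \<and> \<sigma> 0 = p \<longrightarrow>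
               (\<exists>\<delta>>0. \<forall>s\<in>J. \<bar>s\<bar> < \<delta> \<longrightarrow> f (\<sigma> s) \<in> D_plus (f \<circ> \<gamma>) 0)))
       \<and> (singular_curvature A f \<nu> \<gamma> 0 < 0 \<longrightarrow>
            (\<forall>J \<sigma>. null_curve X A f J \<sigma> \<and> 0 \<in> J \<and> \<sigma> 0 = p \<longrightarrow>
               (\<exists>\<delta>>0. \<forall>s\<in>J. \<bar>s\<bar> < \<delta> \<longrightarrow> f (\<sigma> s) \<in> D_minus (f \<circ> \<gamma>) 0)))
       \<and> (singular_curvature A f \<nu> \<gamma> 0 > 0 \<longrightarrow>
            (\<exists>U. openin X U \<and> p \<in> U \<and> f ` U \<subseteq> D_plus (f \<circ> \<gamma>) 0))"
proof -
  let ?is_curvature = "\<lambda>k. \<exists>c\<in>A. \<exists>\<eta>. \<gamma> 0 \<in> fst c \<and> null_vector c f (\<gamma> 0) \<eta> \<and>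
    det2 (velocity c \<gamma> 0) \<eta> > 0 \<and> k = singular_curvature_via c \<eta> f \<nu> \<gamma> 0"
  have \<gamma>0: "\<gamma> 0 = p" using assms(4) by (simp add: singular_curve_def)
  obtain c\<^sub>0 where c0: "c\<^sub>0 \<in> A" "p \<in> fst c\<^sub>0" using assms(3) by (auto simp: cuspidal_edge_def)
  \<comment> \<open>Without a positively oriented null vector, the choice in the definition of the singular
    curvature would be arbitrary.\<close>
  have "\<exists>k. ?is_curvature k"
  proof -
    obtain W \<phi> V \<Phi> where curve: "cuspidal_edge_singular_curve (in_coords c\<^sub>0 f) (in_coords c\<^sub>0 \<nu>)
        (snd c\<^sub>0 ` fst c\<^sub>0) W \<phi> V \<Phi> {t \<in> I. \<gamma> t \<in> fst c\<^sub>0} (\<lambda>t. snd c\<^sub>0 (\<gamma> t)) (f \<circ> \<gamma>)"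
      and \<phi>0: "\<phi> 0 = snd c\<^sub>0 p"
      using singular_curve_in_chart[OF assms c0] by blast
    show ?thesis
      using cuspidal_edge_singular_curve.positively_oriented_null_vector[OF curve] c0
      by (auto simp: null_vector_def diff_at_def velocity_def \<gamma>0 \<phi>0)
  qed
  then have "?is_curvature (singular_curvature A f \<nu> \<gamma> 0)"
    unfolding singular_curvature_def by (rule someI_ex)
  \<comment> \<open>All further computations take place in the chart and with the null vector that
    realize the chosen value of the curvature.\<close>
  then obtain c \<eta> where c: "c \<in> A" "p \<in> fst c" and \<eta>: "null_vector c f p \<eta>" "det2 (velocity c \<gamma> 0) \<eta> > 0"
    and via: "singular_curvature A f \<nu> \<gamma> 0 = singular_curvature_via c \<eta> f \<nu> \<gamma> 0"
    unfolding \<gamma>0 by blast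
  obtain W \<phi> V \<Phi> where curve: "cuspidal_edge_singular_curve (in_coords c f) (in_coords c \<nu>)
      (snd c ` fst c) W \<phi> V \<Phi> {t \<in> I. \<gamma> t \<in> fst c} (\<lambda>t. snd c (\<gamma> t)) (f \<circ> \<gamma>)"
    and \<phi>0: "\<phi> 0 = snd c p"
    using singular_curve_in_chart[OF assms c] by blast
  note cc = oriented_surface_chart[OF assms(1) c(1)]
  interpret C: cuspidal_edge_singular_curve "in_coords c f" "in_coords c \<nu>" "snd c ` fst c" W \<phi> V \<Phi>
    "{t \<in> I. \<gamma> t \<in> fst c}" "\<lambda>t. snd c (\<gamma> t)" "f \<circ> \<gamma>"
    by (rule curve)
  have lam: "C.lam = signed_area_density c f \<nu>"
    by (simp add: fun_eq_iff C.lam_def signed_area_density_def)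
  have sgn_curvature: "sgn (singular_curvature A f \<nu> \<gamma> 0) = sgn (C.n \<bullet> C.a)"
    using C.sgn_singular_curvature[of \<eta>] \<eta> c(2)
    by (simp add: via singular_curvature_via_def lam \<phi>0 \<gamma>0 in_coords_chart[OF cc] null_vector_def
        diff_at_def velocity_def C.y_def C.y'_def Let_def)
  have F: "in_coords c f (snd c r) = f r" if "r \<in> fst c" for r
    using in_coords_chart[OF cc that] .
  \<comment> \<open>Proved first, since the claim on null curves for positive curvature follows from
    it by continuity.\<close>
  have neighborhood: "\<exists>U. openin X U \<and> p \<in> U \<and> f ` U \<subseteq> D_plus (f \<circ> \<gamma>) 0"
    if pos: "singular_curvature A f \<nu> \<gamma> 0 > 0"
  proof -
    have "C.n \<bullet> C.a > 0" using sgn_curvature pos by (metis sgn_greater)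
    \<comment> \<open>So the principal normal is a genuine unit vector rather than the default 0, as
      \<open>n_q\<close> requires.\<close>
    moreover from this have "C.n \<noteq> 0" by auto
    ultimately obtain U where U: "open U" "snd c p \<in> U"
        "\<And>x. x \<in> U \<Longrightarrow> C.n \<bullet> (in_coords c f x - in_coords c f (snd c p)) \<ge> 0"
      using C.image_in_half_space[OF _ C.n_b C.n_q] unfolding \<phi>0 by blast
    have "f r \<in> D_plus (f \<circ> \<gamma>) 0" if "r \<in> fst c" "snd c r \<in> U" for r
      using U(3)[OF that(2)] that(1) c(2) by (simp add: F D_plus_def C.n_def \<gamma>0)
    then show ?thesis
      using chart_on_open_preimage[OF cc U(1)] U(2) c(2)
      by (intro exI[of _ "{q \<in> fst c. snd c q \<in> U}"]) auto
  qed
  moreover have "\<exists>\<delta>>0. \<forall>s\<in>J. \<bar>s\<bar> < \<delta> \<longrightarrow> f (\<sigma> s) \<in> D_plus (f \<circ> \<gamma>) 0"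
    if pos: "singular_curvature A f \<nu> \<gamma> 0 > 0" and \<sigma>: "null_curve X A f J \<sigma>" "0 \<in> J" "\<sigma> 0 = p" for J \<sigma>
  proof -
    obtain U where "openin X U" "p \<in> U" "f ` U \<subseteq> D_plus (f \<circ> \<gamma>) 0"
      using neighborhood[OF pos] by blast
    then show ?thesis
      using regular_curve_near[of X A J \<sigma> U] \<sigma> unfolding null_curve_def by blast
  qed
  moreover have "\<exists>\<delta>>0. \<forall>s\<in>J. \<bar>s\<bar> < \<delta> \<longrightarrow> f (\<sigma> s) \<in> D_minus (f \<circ> \<gamma>) 0"
    if neg: "singular_curvature A f \<nu> \<gamma> 0 < 0" and \<sigma>: "null_curve X A f J \<sigma>" "0 \<in> J" "\<sigma> 0 = p" for J \<sigma>
  proof -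
    have "C.n \<bullet> C.a < 0" using sgn_curvature neg by (metis sgn_less)
    have reg: "regular_curve X A J \<sigma>" using \<sigma>(1) by (simp add: null_curve_def)
    have "p \<in> singular_points X A f" using assms(3) by (simp add: cuspidal_edge_def)
    then have v: "null_vector c f p (velocity c \<sigma> 0)"
      using \<sigma> c by (auto simp: null_curve_def)
    have "((\<lambda>s. snd c (\<sigma> s)) has_vector_derivative velocity c \<sigma> 0) (at 0)"
      unfolding velocity_def
      by (rule has_vector_derivative_vector_derivative_smooth[of "{t \<in> J. \<sigma> t \<in> fst c}"])
         (use reg \<sigma> c in \<open>auto simp: regular_curve_def\<close>)
    then have "\<forall>\<^sub>F s in nhds 0. C.n \<bullet> (in_coords c f (snd c (\<sigma> s)) - in_coords c f (\<phi> 0)) \<le> 0"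
      by (rule C.null_curve_in_half_space[OF \<open>C.n \<bullet> C.a < 0\<close> C.n_b])
         (use v in \<open>simp_all add: \<sigma>(3) \<phi>0 null_vector_def diff_at_def\<close>)
    then obtain \<delta>\<^sub>1 where "\<delta>\<^sub>1 > 0"
      and \<delta>1: "\<And>s. \<bar>s\<bar> < \<delta>\<^sub>1 \<Longrightarrow> C.n \<bullet> (in_coords c f (snd c (\<sigma> s)) - in_coords c f (\<phi> 0)) \<le> 0"
      by (auto simp: eventually_nhds_metric)
    \<comment> \<open>The estimate for \<open>in_coords c f\<close> speaks about \<open>f\<close>
      itself only while the curve stays in the domain of \<open>c\<close>.\<close>
    obtain \<delta>\<^sub>2 where "\<delta>\<^sub>2 > 0" and \<delta>2: "\<And>s. \<bar>s\<bar> < \<delta>\<^sub>2 \<Longrightarrow> \<sigma> s \<in> fst c"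
      using regular_curve_near[OF reg, of "fst c"] cc c \<sigma> by (auto simp: chart_on_def)
    have "f (\<sigma> s) \<in> D_minus (f \<circ> \<gamma>) 0" if "\<bar>s\<bar> < min \<delta>\<^sub>1 \<delta>\<^sub>2" for s
      using \<delta>1[of s] \<delta>2[of s] that c(2) by (simp add: F \<phi>0 D_minus_def C.n_def \<gamma>0)
    then show ?thesis
      using \<open>\<delta>\<^sub>1 > 0\<close> \<open>\<delta>\<^sub>2 > 0\<close> by (intro exI[of _ "min \<delta>\<^sub>1 \<delta>\<^sub>2"]) auto
  qed
  ultimately show ?thesis by blast
qed

end
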